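(* Let $\langle \mathbb{P}, \leq_{\mathbb{P}}, 1_{\mathbb{P}}, \perp_{\mathbb{P}}\rangle$ be a Suslin c.c.c. forcing notion in the ground model $\mathbf{V}$. Then $\mathbb{P}$ does not add any real that is not promptly split by $\mathbf{V}\cap(\mathcal{P}(\omega))^\omega$: that is, if $G$ is $(\mathbf{V},\mathbb{P})$-generic, then for every infinite $a\subseteq\omega$ in $\mathbf{V}[G]$ there is a sequence $X\in\mathbf{V}\cap(\mathcal{P}(\omega))^\omega$ which promptly splits $a$.
   Context: A forcing notion $\langle \mathbb{P}, \leq_{\mathbb{P}}, 1_{\mathbb{P}}, \perp_{\mathbb{P}}\rangle$ is Suslin c.c.c. if it has the countable chain condition and there are analytic sets $R_0\subseteq\omega^\omega$ and $R_1,R_2\subseteq\omega^\omega\times\omega^\omega$ with $\mathbb{P}=R_0$, $\{(q,p)\in\mathbb{P}\times\mathbb{P}: q\leq_{\mathbb{P}}p\}=R_1$, and $\{(p,q)\in\mathbb{P}\times\mathbb{P}: \text{no } r\in\mathbb{P} \text{ satisfies } r\leq_{\mathbb{P}}p \text{ and } r\leq_{\mathbb{P}} q\}=R_2$. For $x\subseteq\omega$ write $x^0=x$ and $x^1=\omega\setminus x$. A sequence $X=\langle x_i:i\in\omega\rangle$ of subsets of $\omega$ promptly splits $a\subseteq\omega$ if for each $n\in\omega$ and each $\sigma\in 2^{n+1}$, the set $\left(\bigcap_{i<n+1}x_i^{\sigma(i)}\right)\cap a$ is infinite. *)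

theory Defs
  imports "HOL-Analysis.Analysis" "HOL-Library.Infinite_Typeclass" "HOL-Library.Multiset"
begin

section \<open>Suslin c.c.c. forcing notions\<close>

record 'p forcing =
  conds :: "'p set"
  le :: "'p \<Rightarrow> 'p \<Rightarrow> bool"  (infix \<open>\<preceq>\<index>\<close> 50)
  maxel :: 'p

definition forcing_notion :: "('p, 'm) forcing_scheme \<Rightarrow> bool" where
  "forcing_notion P \<longleftrightarrow>
     maxel P \<in> conds P \<and>
     (\<forall>p\<in>conds P. p \<preceq>\<^bsub>P\<^esub> p \<and> p \<preceq>\<^bsub>P\<^esub> maxel P) \<and>
     (\<forall>p\<in>conds P. \<forall>q\<in>conds P. \<forall>r\<in>conds P. p \<preceq>\<^bsub>P\<^esub> q \<longrightarrow> q \<preceq>\<^bsub>P\<^esub> r \<longrightarrow> p \<preceq>\<^bsub>P\<^esub> r)"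

definition incompatible :: "('p, 'm) forcing_scheme \<Rightarrow> 'p \<Rightarrow> 'p \<Rightarrow> bool" where
  "incompatible P p q \<longleftrightarrow> \<not> (\<exists>r\<in>conds P. r \<preceq>\<^bsub>P\<^esub> p \<and> r \<preceq>\<^bsub>P\<^esub> q)"

definition ccc :: "('p, 'm) forcing_scheme \<Rightarrow> bool" where
  "ccc P \<longleftrightarrow>
     (\<forall>A\<subseteq>conds P. (\<forall>p\<in>A. \<forall>q\<in>A. p \<noteq> q \<longrightarrow> incompatible P p q) \<longrightarrow> countable A)"

text \<open>The type \<^typ>\<open>nat \<Rightarrow> nat\<close> carries the product of the discrete topologies, i.e. it is Baire
  space.\<close>

definition analytic_set :: "'a::topological_space set \<Rightarrow> bool" where
  "analytic_set A \<longleftrightarrow> A = {} \<or> (\<exists>f :: (nat \<Rightarrow> nat) \<Rightarrow> 'a. continuous_on UNIV f \<and> A = range f)"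

definition suslin_ccc :: "(nat \<Rightarrow> nat, 'm) forcing_scheme \<Rightarrow> bool" where
  "suslin_ccc P \<longleftrightarrow>
     forcing_notion P \<and> ccc P \<and>
     analytic_set (conds P) \<and>
     analytic_set {(q, p). q \<in> conds P \<and> p \<in> conds P \<and> q \<preceq>\<^bsub>P\<^esub> p} \<and>
     analytic_set {(p, q). p \<in> conds P \<and> q \<in> conds P \<and> incompatible P p q}"


section \<open>Names\<close>

text \<open>The ground model \<open>V\<close> is the universe of HOL, and generic extensions are handled through names
  and the forcing relation. A name is a well-founded set of pairs (name, condition), given by a
  partial enumeration over an arbitrary index type \<^typ>\<open>'i\<close>, whose cardinality bounds the
  hereditary size of the names. Two names with the same pairs but different enumerations are interchangeable, since
  everything below depends on the pairs only.\<close>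

datatype ('i, 'p) name = Name "'i \<Rightarrow> (('i, 'p) name \<times> 'p) option"

primrec pairs :: "('i, 'p) name \<Rightarrow> (('i, 'p) name \<times> 'p) set" where
  "pairs (Name f) = ran f"

inductive_set names :: "('p, 'm) forcing_scheme \<Rightarrow> ('i, 'p) name set" for P where
  "(\<And>b r. (b, r) \<in> pairs a \<Longrightarrow> b \<in> names P \<and> r \<in> conds P) \<Longrightarrow> a \<in> names P"

definition mk_name :: "(('i, 'p) name \<times> 'p) set \<Rightarrow> ('i, 'p) name" where
  "mk_name S = (SOME a. pairs a = S)"

lemma pairs_mk_name:
  fixes S :: "(('i::infinite, 'p) name \<times> 'p) set"
  assumes "countable S"
  shows "pairs (mk_name S) = S"
proof -
  obtain e :: "nat \<Rightarrow> 'i" where e: "inj e"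
    using infinite_UNIV infinite_countable_subset by blast
  define f where
    "f = (\<lambda>i. if i \<in> e ` to_nat_on S ` S then Some (from_nat_into S (inv e i)) else None)"
  have "ran f = S"
  proof -
    have "f (e (to_nat_on S x)) = Some x" if "x \<in> S" for x
      using that assms e by (auto simp: f_def)
    moreover have "y \<in> S" if "f i = Some y" for i y
      using that assms e by (auto simp: f_def split: if_splits)
    ultimately show ?thesis by (force simp: ran_def)
  qed
  then have "pairs (Name f) = S" by simp
  then show ?thesis unfolding mk_name_def by (rule someI)
qed

text \<open>Canonical names for natural numbers (von Neumann), sets of natural numbers, ordered pairs
  (Kuratowski), and sequences of sets of natural numbers (as sets of ordered pairs).\<close>

fun check_nat :: "('p, 'm) forcing_scheme \<Rightarrow> nat \<Rightarrow> ('i::infinite, 'p) name" where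
  "check_nat P n = mk_name ((\<lambda>m. (check_nat P m, maxel P)) ` {..<n})"

declare check_nat.simps [simp del]

definition check_set :: "('p, 'm) forcing_scheme \<Rightarrow> nat set \<Rightarrow> ('i::infinite, 'p) name" where
  "check_set P x = mk_name ((\<lambda>n. (check_nat P n, maxel P)) ` x)"

definition pair_name ::
    "('p, 'm) forcing_scheme \<Rightarrow> ('i::infinite, 'p) name \<Rightarrow> ('i, 'p) name \<Rightarrow> ('i, 'p) name" where
  "pair_name P a b =
     mk_name {(mk_name {(a, maxel P)}, maxel P),
              (mk_name {(a, maxel P), (b, maxel P)}, maxel P)}"

definition check_seq :: "('p, 'm) forcing_scheme \<Rightarrow> (nat \<Rightarrow> nat set) \<Rightarrow> ('i::infinite, 'p) name" where
  "check_seq P X = mk_name (range (\<lambda>n. (pair_name P (check_nat P n) (check_set P (X n)), maxel P)))"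

definition omega_name :: "('p, 'm) forcing_scheme \<Rightarrow> ('i::infinite, 'p) name" where
  "omega_name P = check_set P UNIV"


section \<open>The forcing relation\<close>

definition child_rel :: "(('i, 'p) name \<times> ('i, 'p) name) set" where
  "child_rel = {(b, a). \<exists>r. (b, r) \<in> pairs a}"

lemma wf_child_rel: "wf child_rel"
proof (rule wfUNIVI)
  fix Q :: "('i, 'p) name \<Rightarrow> bool" and a
  assume IH: "\<forall>x. (\<forall>y. (y, x) \<in> child_rel \<longrightarrow> Q y) \<longrightarrow> Q x"
  show "Q a"
  proof (induction a)
    case (Name f)
    have "Q b" if br: "(b, r) \<in> ran f" for b r
    proof -
      from br obtain i where "f i = Some (b, r)" by (auto simp: ran_def)
      then show ?thesis
        using Name[of "Some (b, r)" "(b, r)" b] by (metis fsts.intros option.set_intros rangeI fst_conv)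
    qed
    then show ?case using IH[rule_format, of "Name f"] by (auto simp: child_rel_def)
  qed
qed

lemma child_rel_mult:
  assumes "(c, s) \<in> pairs a"
  shows "({#c, b#}, {#a, b#}) \<in> mult child_rel" "({#b, c#}, {#b, a#}) \<in> mult child_rel"
    "({#c, b#}, {#b, a#}) \<in> mult child_rel" "({#b, c#}, {#a, b#}) \<in> mult child_rel"
proof -
  have "(c, a) \<in> child_rel" using assms by (auto simp: child_rel_def)
  then have "({#b#} + {#c#}, {#b#} + {#a#}) \<in> mult child_rel"
    by (intro one_step_implies_mult) auto
  then show "({#c, b#}, {#a, b#}) \<in> mult child_rel" "({#b, c#}, {#b, a#}) \<in> mult child_rel"
    "({#c, b#}, {#b, a#}) \<in> mult child_rel" "({#b, c#}, {#a, b#}) \<in> mult child_rel"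
    by (simp_all add: add_mset_commute)
qed

text \<open>\<open>forces_eq P a b p\<close> and \<open>forces_mem P a b p\<close> express that \<open>p\<close> forces \<open>a = b\<close> and \<open>a \<in> b\<close>,
  respectively.\<close>

function (sequential)
  forces_eq :: "('p, 'm) forcing_scheme \<Rightarrow> ('i, 'p) name \<Rightarrow> ('i, 'p) name \<Rightarrow> 'p \<Rightarrow> bool"
    (infix \<open>\<^bold>=\<index>\<close> 50) and
  forces_mem :: "('p, 'm) forcing_scheme \<Rightarrow> ('i, 'p) name \<Rightarrow> ('i, 'p) name \<Rightarrow> 'p \<Rightarrow> bool"
    (infix \<open>\<^bold>\<in>\<index>\<close> 50)
where
  "forces_eq P a b p \<longleftrightarrow>
     (\<forall>(c, s)\<in>pairs a. \<forall>q\<in>conds P. q \<preceq>\<^bsub>P\<^esub> p \<and> q \<preceq>\<^bsub>P\<^esub> s \<longrightarrow> forces_mem P c b q) \<and>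
     (\<forall>(c, s)\<in>pairs b. \<forall>q\<in>conds P. q \<preceq>\<^bsub>P\<^esub> p \<and> q \<preceq>\<^bsub>P\<^esub> s \<longrightarrow> forces_mem P c a q)"
| "forces_mem P a b p \<longleftrightarrow>
     (\<forall>q\<in>conds P. q \<preceq>\<^bsub>P\<^esub> p \<longrightarrow>
        (\<exists>r\<in>conds P. r \<preceq>\<^bsub>P\<^esub> q \<and> (\<exists>(c, s)\<in>pairs b. r \<preceq>\<^bsub>P\<^esub> s \<and> forces_eq P a c r)))"
  by pat_completeness auto

termination
  by (relation "inv_image (mult child_rel)
        (case_sum (\<lambda>(P, a, b, p). {#a, b#}) (\<lambda>(P, a, b, p). {#a, b#}))")
    (auto intro!: wf_inv_image wf_mult wf_child_rel intro: child_rel_mult)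

declare forces_eq.simps [simp del] forces_mem.simps [simp del]

text \<open>A sentence of the forcing language is identified with the predicate "\<open>p\<close> forces the sentence"
  on conditions. The connectives are the usual clauses of the forcing relation; disjunction,
  implication and existential quantification are derived from negation, conjunction and universal
  quantification.\<close>

type_synonym 'p sentence = "'p \<Rightarrow> bool"

definition fnot :: "('p, 'm) forcing_scheme \<Rightarrow> 'p sentence \<Rightarrow> 'p sentence"
    (\<open>\<^bold>\<not>\<index> _\<close> [40] 40) where
  "(\<^bold>\<not>\<^bsub>P\<^esub> \<phi>) = (\<lambda>p. \<forall>q\<in>conds P. q \<preceq>\<^bsub>P\<^esub> p \<longrightarrow> \<not> \<phi> q)"

definition fand :: "'p sentence \<Rightarrow> 'p sentence \<Rightarrow> 'p sentence"  (infixr \<open>\<^bold>\<and>\<close> 35) where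
  "(\<phi> \<^bold>\<and> \<psi>) = (\<lambda>p. \<phi> p \<and> \<psi> p)"

definition f_or :: "('p, 'm) forcing_scheme \<Rightarrow> 'p sentence \<Rightarrow> 'p sentence \<Rightarrow> 'p sentence"
    (infixr \<open>\<^bold>\<or>\<index>\<close> 30) where
  "(\<phi> \<^bold>\<or>\<^bsub>P\<^esub> \<psi>) = (\<^bold>\<not>\<^bsub>P\<^esub> ((\<^bold>\<not>\<^bsub>P\<^esub> \<phi>) \<^bold>\<and> (\<^bold>\<not>\<^bsub>P\<^esub> \<psi>)))"

definition fimp :: "('p, 'm) forcing_scheme \<Rightarrow> 'p sentence \<Rightarrow> 'p sentence \<Rightarrow> 'p sentence"
    (infixr \<open>\<^bold>\<longrightarrow>\<index>\<close> 25) where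
  "(\<phi> \<^bold>\<longrightarrow>\<^bsub>P\<^esub> \<psi>) = (\<^bold>\<not>\<^bsub>P\<^esub> (\<phi> \<^bold>\<and> (\<^bold>\<not>\<^bsub>P\<^esub> \<psi>)))"

text \<open>\<open>fall\<close>, \<open>fex\<close> quantify over the generic extension (i.e. over all names), whereas
  \<open>fex_ground\<close> quantifies over objects of the ground model.\<close>

definition fall :: "('p, 'm) forcing_scheme \<Rightarrow> (('i, 'p) name \<Rightarrow> 'p sentence) \<Rightarrow> 'p sentence" where
  "fall P \<Phi> = (\<lambda>p. \<forall>a\<in>names P. \<Phi> a p)"

definition fex :: "('p, 'm) forcing_scheme \<Rightarrow> (('i, 'p) name \<Rightarrow> 'p sentence) \<Rightarrow> 'p sentence" where
  "fex P \<Phi> = (\<^bold>\<not>\<^bsub>P\<^esub> fall P (\<lambda>a. \<^bold>\<not>\<^bsub>P\<^esub> \<Phi> a))"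

definition fex_ground :: "('p, 'm) forcing_scheme \<Rightarrow> ('x \<Rightarrow> 'p sentence) \<Rightarrow> 'p sentence" where
  "fex_ground P \<Phi> = (\<^bold>\<not>\<^bsub>P\<^esub> (\<lambda>p. \<forall>x. (\<^bold>\<not>\<^bsub>P\<^esub> \<Phi> x) p))"

text \<open>\<open>V\<close> being the whole universe, "\<open>\<phi>\<close> holds in \<open>V[G]\<close> for every \<open>(V, P)\<close>-generic \<open>G\<close>" means that the
  largest condition forces \<open>\<phi>\<close>.\<close>

definition forced :: "('p, 'm) forcing_scheme \<Rightarrow> 'p sentence \<Rightarrow> bool"  (\<open>\<tturnstile>\<index> _\<close> [20] 20) where
  "(\<tturnstile>\<^bsub>P\<^esub> \<phi>) \<longleftrightarrow> \<phi> (maxel P)"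


section \<open>Set-theoretic notions in the generic extension\<close>

text \<open>Each of the following is the usual first-order formula, evaluated in the extension. Arguments
  of type \<^typ>\<open>('i, 'p) name \<Rightarrow> 'p sentence\<close> are definable classes.\<close>

definition fall_in ::
    "('p, 'm) forcing_scheme \<Rightarrow> (('i, 'p) name \<Rightarrow> 'p sentence) \<Rightarrow> (('i, 'p) name \<Rightarrow> 'p sentence)
      \<Rightarrow> 'p sentence" where
  "fall_in P A \<Phi> = fall P (\<lambda>a. A a \<^bold>\<longrightarrow>\<^bsub>P\<^esub> \<Phi> a)"

definition fex_in ::
    "('p, 'm) forcing_scheme \<Rightarrow> (('i, 'p) name \<Rightarrow> 'p sentence) \<Rightarrow> (('i, 'p) name \<Rightarrow> 'p sentence)
      \<Rightarrow> 'p sentence" where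
  "fex_in P A \<Phi> = fex P (\<lambda>a. A a \<^bold>\<and> \<Phi> a)"

definition in_omega :: "('p, 'm) forcing_scheme \<Rightarrow> ('i::infinite, 'p) name \<Rightarrow> 'p sentence" where
  "in_omega P n = (n \<^bold>\<in>\<^bsub>P\<^esub> omega_name P)"

definition fsubset ::
    "('p, 'm) forcing_scheme \<Rightarrow> ('i, 'p) name \<Rightarrow> ('i, 'p) name \<Rightarrow> 'p sentence"
    (infix \<open>\<^bold>\<subseteq>\<index>\<close> 50) where
  "(a \<^bold>\<subseteq>\<^bsub>P\<^esub> b) = fall_in P (\<lambda>x. x \<^bold>\<in>\<^bsub>P\<^esub> a) (\<lambda>x. x \<^bold>\<in>\<^bsub>P\<^esub> b)"

definition is_fun ::
    "('p, 'm) forcing_scheme \<Rightarrow> ('i::infinite, 'p) name \<Rightarrow> (('i, 'p) name \<Rightarrow> 'p sentence) \<Rightarrow>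
      (('i, 'p) name \<Rightarrow> 'p sentence) \<Rightarrow> 'p sentence" where
  "is_fun P f A B =
     (fall_in P (\<lambda>z. z \<^bold>\<in>\<^bsub>P\<^esub> f) (\<lambda>z. fex_in P A (\<lambda>x. fex_in P B (\<lambda>y. z \<^bold>=\<^bsub>P\<^esub> pair_name P x y))) \<^bold>\<and>
      fall_in P A (\<lambda>x. fex_in P B (\<lambda>y. pair_name P x y \<^bold>\<in>\<^bsub>P\<^esub> f)) \<^bold>\<and>
      fall P (\<lambda>x. fall P (\<lambda>y. fall P (\<lambda>y'.
        pair_name P x y \<^bold>\<in>\<^bsub>P\<^esub> f \<^bold>\<and> pair_name P x y' \<^bold>\<in>\<^bsub>P\<^esub> f \<^bold>\<longrightarrow>\<^bsub>P\<^esub> y \<^bold>=\<^bsub>P\<^esub> y'))))"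

definition is_bij ::
    "('p, 'm) forcing_scheme \<Rightarrow> ('i::infinite, 'p) name \<Rightarrow> (('i, 'p) name \<Rightarrow> 'p sentence) \<Rightarrow>
      (('i, 'p) name \<Rightarrow> 'p sentence) \<Rightarrow> 'p sentence" where
  "is_bij P f A B =
     (is_fun P f A B \<^bold>\<and>
      fall_in P B (\<lambda>y. fex_in P A (\<lambda>x. pair_name P x y \<^bold>\<in>\<^bsub>P\<^esub> f)) \<^bold>\<and>
      fall P (\<lambda>x. fall P (\<lambda>x'. fall P (\<lambda>y.
        pair_name P x y \<^bold>\<in>\<^bsub>P\<^esub> f \<^bold>\<and> pair_name P x' y \<^bold>\<in>\<^bsub>P\<^esub> f \<^bold>\<longrightarrow>\<^bsub>P\<^esub> x \<^bold>=\<^bsub>P\<^esub> x'))))"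

definition is_infinite ::
    "('p, 'm) forcing_scheme \<Rightarrow> (('i::infinite, 'p) name \<Rightarrow> 'p sentence) \<Rightarrow> 'p sentence" where
  "is_infinite P A =
     (\<^bold>\<not>\<^bsub>P\<^esub> fex_in P (in_omega P) (\<lambda>n. fex P (\<lambda>f. is_bij P f (\<lambda>i. i \<^bold>\<in>\<^bsub>P\<^esub> n) A)))"

text \<open>\<open>k \<in> X(i)\<close> for a sequence \<open>X\<close>\<close>

definition in_value ::
    "('p, 'm) forcing_scheme \<Rightarrow> ('i::infinite, 'p) name \<Rightarrow> ('i, 'p) name \<Rightarrow> ('i, 'p) name
      \<Rightarrow> 'p sentence" where
  "in_value P k X i = fex P (\<lambda>y. pair_name P i y \<^bold>\<in>\<^bsub>P\<^esub> X \<^bold>\<and> k \<^bold>\<in>\<^bsub>P\<^esub> y)"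

text \<open>The two bounded classes used below are \<open>n + 1 = n \<union> {n}\<close> and \<open>2 = {0, 1}\<close>; the first conjunct
  in the class whose infinity is asserted says \<open>k \<in> x\<^sub>i ^ \<sigma>(i)\<close> for all \<open>i \<in> n + 1\<close>.\<close>

definition promptly_splits ::
    "('p, 'm) forcing_scheme \<Rightarrow> ('i::infinite, 'p) name \<Rightarrow> ('i, 'p) name \<Rightarrow> 'p sentence" where
  "promptly_splits P X a =
     fall_in P (in_omega P) (\<lambda>n.
       let succ_n = (\<lambda>i. i \<^bold>\<in>\<^bsub>P\<^esub> n \<^bold>\<or>\<^bsub>P\<^esub> i \<^bold>=\<^bsub>P\<^esub> n);
           two = (\<lambda>j. j \<^bold>=\<^bsub>P\<^esub> check_nat P 0 \<^bold>\<or>\<^bsub>P\<^esub> j \<^bold>=\<^bsub>P\<^esub> check_nat P 1)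
       in fall_in P (\<lambda>\<sigma>. is_fun P \<sigma> succ_n two) (\<lambda>\<sigma>.
            is_infinite P (\<lambda>k.
              fall_in P succ_n (\<lambda>i.
                (pair_name P i (check_nat P 0) \<^bold>\<in>\<^bsub>P\<^esub> \<sigma> \<^bold>\<longrightarrow>\<^bsub>P\<^esub> in_value P k X i) \<^bold>\<and>
                (pair_name P i (check_nat P 1) \<^bold>\<in>\<^bsub>P\<^esub> \<sigma> \<^bold>\<longrightarrow>\<^bsub>P\<^esub>
                   in_omega P k \<^bold>\<and> (\<^bold>\<not>\<^bsub>P\<^esub> in_value P k X i)))
              \<^bold>\<and> k \<^bold>\<in>\<^bsub>P\<^esub> a)))"

end

theory Submission
  imports Defs
begin

text \<open>
  Suppose \<open>p\<close> forces \<open>a\<close> to be an infinite set of natural numbers. By the countable chain condition, the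
  name \<open>a\<close> is coded by countable antichains \<open>A n\<close> of conditions forcing \<open>n \<in> a\<close>. Let \<open>U\<close> be the family
  of all \<open>x\<close> such that some \<open>q\<close> below \<open>p\<close> forces \<open>x \<inter> a\<close> to be finite; as this means
  that \<open>q\<close> is incompatible with all members of \<open>A n\<close> for almost all \<open>n \<in> x\<close>, the family \<open>U\<close> is analytic.
  An analytic set is meagre or comeagre in some basic open set, and in either case there are intervals
  \<open>I l\<close> and a set \<open>g\<close> such that agreement with \<open>g\<close> on infinitely many of the \<open>I l\<close> excludes from \<open>U\<close>
  (respectively, within the basic open set, implies membership in \<open>U\<close>).

  In the comeagre case an uncountable almost disjoint family of sets of indices \<open>l\<close> gives uncountably many
  members of \<open>U\<close> any two of which have cofinite union. The corresponding conditions form an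
  uncountable antichain, a contradiction. In the meagre case let \<open>X\<close> be constant on each \<open>I l\<close> and realize
  every finite pattern on infinitely many of them. Each Boolean combination from \<open>X\<close> then contains a set
  outside of \<open>U\<close>, and since \<open>U\<close> is closed under subsets, it meets \<open>a\<close> in an infinite set.
\<close>

section \<open>Analytic sets and Baire category\<close>

definition cyl :: "'a list \<Rightarrow> (nat \<Rightarrow> 'a) set" where
  "cyl s = {x. \<forall>i<length s. x i = s ! i}"

definition nowhere_dense :: "(nat \<Rightarrow> 'a) set \<Rightarrow> bool" where
  "nowhere_dense M \<longleftrightarrow> (\<forall>s. \<exists>w. cyl (s @ w) \<inter> M = {})"

definition meagre :: "(nat \<Rightarrow> 'a) set \<Rightarrow> bool" where
  "meagre M \<longleftrightarrow> (\<exists>F :: nat \<Rightarrow> (nat \<Rightarrow> 'a) set. (\<forall>k. nowhere_dense (F k)) \<and> M \<subseteq> (\<Union>k. F k))"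

text \<open>Comeagreness in interval form: for strictly increasing \<open>n\<close> the matching
  sequences form a dense G-delta set in the product of discrete topologies, and each comeagre subset
  of Cantor space contains a set of this form. Carrying \<open>n\<close> and \<open>g\<close> along
  turns category into explicit constructions of sets of natural numbers.\<close>

definition matches :: "(nat \<Rightarrow> nat) \<Rightarrow> (nat \<Rightarrow> 'a) \<Rightarrow> (nat \<Rightarrow> 'a) \<Rightarrow> bool" where
  "matches n g x \<longleftrightarrow> (\<exists>\<^sub>\<infinity>l. \<forall>i\<in>{n l..<n (Suc l)}. x i = g i)"

lemma cyl_Nil: "cyl [] = UNIV"
  by (simp add: cyl_def)

lemma cyl_append: "cyl (s @ w) \<subseteq> cyl s"
  by (auto simp: cyl_def nth_append)

lemma cyl_map: "x \<in> cyl (map x [0..<k])"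
  by (simp add: cyl_def)

lemma cyl_iff_map: "x \<in> cyl s \<longleftrightarrow> map x [0..<length s] = s"
  unfolding cyl_def by (subst list_eq_iff_nth_eq) simp

lemma map_upt_append: "j \<le> k \<Longrightarrow> \<exists>w. map x [0..<k] = map x [0..<j] @ w"
  by (metis map_append upt_add_eq_append le0 le_add_diff_inverse)

lemma cyl_eq_UN_snoc: "cyl s = (\<Union>a. cyl (s @ [a]))"
  by (auto simp: cyl_def nth_append less_Suc_eq)

lemma meagre_subset: "\<lbrakk>meagre M; N \<subseteq> M\<rbrakk> \<Longrightarrow> meagre N"
  unfolding meagre_def by blast

lemma meagre_nowhere_dense: "nowhere_dense M \<Longrightarrow> meagre M"
  unfolding meagre_def by (rule exI[of _ "\<lambda>_. M"]) auto

lemma meagre_empty: "meagre {}"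
  by (rule meagre_nowhere_dense) (simp add: nowhere_dense_def)

lemma meagre_UN:
  assumes "\<And>i::'b::countable. meagre (M i)"
  shows "meagre (\<Union>i. M i)"
proof -
  obtain F :: "'b \<Rightarrow> nat \<Rightarrow> _" where F: "\<And>i k. nowhere_dense (F i k)" "\<And>i. M i \<subseteq> (\<Union>k. F i k)"
    using assms unfolding meagre_def by metis
  define H where "H m = (case prod_decode m of (i, k) \<Rightarrow> F (from_nat i) k)" for m
  have "M i \<subseteq> (\<Union>m. H m)" for i
  proof
    fix x assume "x \<in> M i"
    then obtain k where "x \<in> F i k" using F(2) by blast
    then have "x \<in> H (prod_encode (to_nat i, k))" by (simp add: H_def)
    then show "x \<in> (\<Union>m. H m)" by blast
  qed
  moreover have "nowhere_dense (H m)" for m by (simp add: H_def F(1) split: prod.split)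
  ultimately show ?thesis unfolding meagre_def by blast
qed

lemma meagre_Un: "\<lbrakk>meagre M; meagre N\<rbrakk> \<Longrightarrow> meagre (M \<union> N)"
  using meagre_UN[of "\<lambda>b. if b then M else N"] by (simp add: UNIV_bool Un_commute)

text \<open>Banach category theorem: the cylinders in which a set is meagre together contribute only a
  meagre part.\<close>

lemma nonmeagre_in_cyl:
  fixes M :: "(nat \<Rightarrow> 'a::countable) set"
  assumes "\<not> meagre (M \<inter> cyl s)"
  shows "\<exists>w. \<forall>v. \<not> meagre (M \<inter> cyl (s @ w @ v))"
proof (rule ccontr)
  assume *: "\<not> ?thesis"
  \<comment> \<open>By the negated conclusion every extension of \<open>s\<close> has a further
    extension whose cylinder meets \<open>M\<close> in a meagre set. Removing all these meagre
    pieces leaves a nowhere dense remainder.\<close>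
  define small where "small w = (if meagre (M \<inter> cyl (s @ w)) then M \<inter> cyl (s @ w) else {})" for w
  have "nowhere_dense (M \<inter> cyl s - (\<Union>w. small w))"
    unfolding nowhere_dense_def
  proof
    fix r :: "'a list"
    show "\<exists>w. cyl (r @ w) \<inter> (M \<inter> cyl s - (\<Union>w. small w)) = {}"
    proof (cases "\<exists>v. cyl (r @ v) \<inter> cyl s = {}")
      case False
      \<comment> \<open>Every extension of \<open>r\<close> meets \<open>cyl s\<close>, in
        particular \<open>r @ s\<close> does. A common point makes \<open>r\<close> and
        \<open>s\<close> comparable, so they have a common extension.\<close>
      then obtain x where x: "x \<in> cyl (r @ s) \<inter> cyl s" by blast
      then have "\<exists>u v. r @ u = s @ v"
        using map_upt_append[of "length r" "max (length r) (length s)" x]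
          map_upt_append[of "length s" "max (length r) (length s)" x]
          cyl_append[of r s] by (metis Int_iff cyl_iff_map max.cobounded1 max.cobounded2 subsetD)
      then obtain u v where u: "r @ u = s @ v" by blast
      from * obtain w where "meagre (M \<inter> cyl (s @ v @ w))" by blast
      then have "M \<inter> cyl (r @ u @ w) \<subseteq> small (v @ w)"
        using u by (simp add: small_def flip: append_assoc)
      then show ?thesis by blast
    qed blast
  qed
  moreover have "meagre (\<Union>w. small w)"
    by (rule meagre_UN) (simp add: small_def meagre_empty)
  ultimately have "meagre ((M \<inter> cyl s - (\<Union>w. small w)) \<union> (\<Union>w. small w))"
    using meagre_Un meagre_nowhere_dense by blast
  then have "meagre (M \<inter> cyl s)" by (rule meagre_subset) blast
  with assms show False by blast
qed

text \<open>The finitely many requirements are met one after the other; by \<open>up\<close>,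
  lengthening the word for a new requirement does not spoil the earlier ones.\<close>

lemma uniform_extension:
  assumes dense: "\<And>k s. \<exists>w. s @ w \<in> E k" and up: "\<And>k s w. s \<in> E k \<Longrightarrow> s @ w \<in> E k"
    and "finite F"
  shows "\<exists>w. \<forall>(s, k)\<in>F. s @ w \<in> E k"
  using \<open>finite F\<close>
proof (induction F rule: finite_induct)
  case (insert z F)
  obtain s k where z: "z = (s, k)" by force
  from insert obtain w where w: "\<forall>(s, k)\<in>F. s @ w \<in> E k" by blast
  obtain v where "(s @ w) @ v \<in> E k" using dense by blast
  with w have "\<forall>(s, k)\<in>insert z F. s @ (w @ v) \<in> E k"
    using up z by (fastforce simp flip: append_assoc)
  then show ?case by blast
qed auto

text \<open>Since there are only finitely many binary strings of a given length, one and the same block can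
  be made to work for all of them.\<close>

lemma matching_intervals:
  fixes E :: "nat \<Rightarrow> bool list set"
  assumes dense: "\<And>k s. \<exists>w. s @ w \<in> E k" and up: "\<And>k s w. s \<in> E k \<Longrightarrow> s @ w \<in> E k"
  obtains n g where "strict_mono n" "n 0 = 0"
    "\<And>x k. matches n g x \<Longrightarrow> \<exists>j. map x [0..<j] \<in> E k"
proof -
  have "\<exists>w. w \<noteq> [] \<and> (\<forall>s k. length s = m \<longrightarrow> k \<le> l \<longrightarrow> s @ w \<in> E k)" for m l
  proof -
    have "finite ({s :: bool list. length s = m} \<times> {..l})"
      using finite_lists_length_eq[of "UNIV :: bool set" m] by simp
    from uniform_extension[of E, OF dense up this] obtain w
      where w: "\<forall>(s, k)\<in>{s. length s = m} \<times> {..l}. s @ w \<in> E k" by blast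
    \<comment> \<open>The additional letter makes the block nonempty, which is what lets the
      endpoints of the intervals increase strictly.\<close>
    then have "\<forall>s k. length s = m \<longrightarrow> k \<le> l \<longrightarrow> s @ (w @ [True]) \<in> E k"
      using up by (fastforce simp flip: append_assoc)
    then show ?thesis by blast
  qed
  then obtain W where W: "\<And>m l. W m l \<noteq> []"
    "\<And>m l s k. length s = m \<Longrightarrow> k \<le> l \<Longrightarrow> s @ W m l \<in> E k" by metis
  \<comment> \<open>The word \<open>v l\<close> concatenates the first \<open>l\<close> blocks,
    where block \<open>l\<close> serves all strings of the length reached so far and the sets
    \<open>E 0\<close>, ..., \<open>E l\<close>. The endpoints \<open>n\<close> record the lengths,
    and \<open>g\<close> is the infinite concatenation.\<close>
  define v where "v = rec_nat [] (\<lambda>l u. u @ W (length u) l)"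
  have v: "v 0 = []" "v (Suc l) = v l @ W (length (v l)) l" for l
    by (simp_all add: v_def)
  define n where "n l = length (v l)" for l
  \<comment> \<open>Blocks are nonempty, so \<open>v (Suc i)\<close> is long enough to have an entry
    at position \<open>i\<close>.\<close>
  define g where "g i = v (Suc i) ! i" for i
  have n: "strict_mono n"
    unfolding strict_mono_Suc_iff using W(1) by (simp add: n_def v)
  have pre: "\<exists>u. v l' = v l @ u" if "l \<le> l'" for l l'
    using that by (induction l' rule: dec_induct) (auto simp: v)
  have g: "g i = v l ! i" if "i < n l" for i l
  proof -
    have "i < n (Suc i)" using strict_mono_imp_increasing[OF n, of "Suc i"] by simp
    then show ?thesis
      using pre[of l "Suc i"] pre[of "Suc i" l] that
      by (metis g_def n_def nat_le_linear nth_append)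
  qed
  have "\<exists>j. map x [0..<j] \<in> E k" if x: "matches n g x" for x k
  proof -
    \<comment> \<open>Among infinitely many matching blocks there is one with index at least
      \<open>k\<close>, hence one that was built with \<open>E k\<close> in view.\<close>
    obtain l where l: "k \<le> l" "\<forall>i\<in>{n l..<n (Suc l)}. x i = g i"
      using x unfolding matches_def INFM_nat_le by blast
    have "map x [0..<n (Suc l)] = map x [0..<n l] @ W (n l) l"
    proof (rule nth_equalityI)
      show "length (map x [0..<n (Suc l)]) = length (map x [0..<n l] @ W (n l) l)"
        by (simp add: n_def v)
      fix i assume "i < length (map x [0..<n (Suc l)])"
      then have i: "i < n (Suc l)" by simp
      show "map x [0..<n (Suc l)] ! i = (map x [0..<n l] @ W (n l) l) ! i"
      proof (cases "i < n l")
        case False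
        then have "x i = v (Suc l) ! i" using l(2) i g[OF i] by simp
        with False i show ?thesis by (simp add: nth_append v n_def)
      qed (use i in \<open>simp add: nth_append\<close>)
    qed
    then show ?thesis using W(2)[of "map x [0..<n l]" "n l" k l] l(1)
      by (metis length_map length_upt minus_nat.diff_0)
  qed
  with n show ?thesis using that[of n g] by (simp add: n_def v)
qed

text \<open>Closedness in the product of the discrete topologies.\<close>

definition limit_closed :: "((nat \<Rightarrow> 'a) \<times> (nat \<Rightarrow> 'b)) set \<Rightarrow> bool" where
  "limit_closed C \<longleftrightarrow>
    (\<forall>x y. (\<forall>k. \<exists>(x', y')\<in>C. \<forall>i<k. x' i = x i \<and> y' i = y i) \<longrightarrow> (x, y) \<in> C)"

text \<open>Projections of closed sets have the Baire property, here in interval form. In the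
  nonmeagre case a matching sequence meets countably many dense sets, and this genericity allows a
  witness to be built letter by letter with nonmeagreness as the invariant.\<close>

lemma analytic_dichotomy:
  fixes C :: "((nat \<Rightarrow> bool) \<times> (nat \<Rightarrow> nat)) set"
  assumes closed: "limit_closed C"
  obtains
    (small) n g where "strict_mono n" "n 0 = 0" "\<And>x. matches n g x \<Longrightarrow> x \<notin> fst ` C"
  | (large) s n g where "strict_mono n" "n 0 = 0"
      "\<And>x. \<lbrakk>x \<in> cyl s; matches n g x\<rbrakk> \<Longrightarrow> x \<in> fst ` C"
proof (cases "meagre (fst ` C)")
  case True
  then obtain F :: "nat \<Rightarrow> _" where F: "\<And>k. nowhere_dense (F k)" "fst ` C \<subseteq> (\<Union>k. F k)"
    unfolding meagre_def by blast
  define E where "E k = {s. cyl s \<inter> F k = {}}" for k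
  have "\<exists>w. s @ w \<in> E k" for k s
    using F(1)[of k] unfolding nowhere_dense_def E_def by blast
  moreover have "s @ w \<in> E k" if "s \<in> E k" for k s w
    using that cyl_append[of s w] unfolding E_def by blast
  ultimately obtain n g where n: "strict_mono n" "n 0 = 0"
    "\<And>x k. matches n g x \<Longrightarrow> \<exists>j. map x [0..<j] \<in> E k"
    using matching_intervals[of E] by metis
  have "x \<notin> fst ` C" if x: "matches n g x" for x
  proof
    assume "x \<in> fst ` C"
    then obtain k where "x \<in> F k" using F(2) by blast
    moreover obtain j where "map x [0..<j] \<in> E k" using n(3)[OF x] by blast
    ultimately show False using cyl_map[of x j] unfolding E_def by blast
  qed
  then show ?thesis by (rule small[OF n(1,2)])
next
  case False
  \<comment> \<open>Approximation of the witness by finite words: \<open>U t\<close> collects the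
    points with a witness beginning with \<open>t\<close>, and membership in
    \<open>\<Gamma> t\<close> is the hereditary form of nonmeagreness that survives every extension
    of the cylinder.\<close>
  define U where "U t = fst ` (C \<inter> UNIV \<times> cyl t)" for t
  define \<Gamma> where "\<Gamma> t = {s. \<forall>w. \<not> meagre (U t \<inter> cyl (s @ w))}" for t
  have \<Gamma>_up: "s @ w \<in> \<Gamma> t" if "s \<in> \<Gamma> t" for s w t
    using that by (simp add: \<Gamma>_def)
  have \<Gamma>_dense: "\<exists>w a. s @ w \<in> \<Gamma> (t @ [a])" if "s \<in> \<Gamma> t" for s t
  proof -
    have "\<not> meagre (U t \<inter> cyl s)" using that by (auto simp: \<Gamma>_def dest: spec[of _ "[]"])
    moreover have "U t \<inter> cyl s = (\<Union>a. U (t @ [a]) \<inter> cyl s)"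
      unfolding U_def by (subst cyl_eq_UN_snoc) blast
    ultimately obtain a where "\<not> meagre (U (t @ [a]) \<inter> cyl s)" using meagre_UN by metis
    from nonmeagre_in_cyl[OF this] show ?thesis by (auto simp: \<Gamma>_def)
  qed
  obtain s where s: "s \<in> \<Gamma> []"
    using nonmeagre_in_cyl[of "fst ` C" "[]"] False by (auto simp: \<Gamma>_def U_def cyl_Nil)
  \<comment> \<open>A word in \<open>E t\<close> either settles a letter by which the witness can
    continue after \<open>t\<close>, or excludes \<open>t\<close> for all of its own extensions.
    Along a sequence at which \<open>t\<close> is still live, only the first alternative is
    possible.\<close>
  define E where "E t = {s. (\<exists>a. s \<in> \<Gamma> (t @ [a])) \<or> (\<forall>w. s @ w \<notin> \<Gamma> t)}" for t
  have "\<exists>w. s @ w \<in> E t" for s t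
  proof (cases "\<exists>w. s @ w \<in> \<Gamma> t")
    case True
    then obtain w u a where "(s @ w) @ u \<in> \<Gamma> (t @ [a])" using \<Gamma>_dense by blast
    then have "s @ (w @ u) \<in> E t" unfolding E_def by auto
    then show ?thesis by blast
  qed (auto simp: E_def intro: exI[of _ "[]"])
  moreover have "s @ w \<in> E t" if "s \<in> E t" for s t w
    using that \<Gamma>_up by (auto simp: E_def)
  ultimately obtain n g where n: "strict_mono n" "n 0 = 0"
    and E: "\<And>x k. matches n g x \<Longrightarrow> \<exists>j. map x [0..<j] \<in> E (from_nat k)"
    using matching_intervals[of "\<lambda>k. E (from_nat k)"] by metis
  have "x \<in> fst ` C" if x: "x \<in> cyl s" "matches n g x" for x
  proof -
    define live where "live t \<longleftrightarrow> (\<exists>k. map x [0..<k] \<in> \<Gamma> t)" for t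
    have live_Nil: "live []" using s x(1) unfolding live_def cyl_iff_map by metis
    have live_Suc: "\<exists>a. live (t @ [a])" if t: "live t" for t
    proof -
      obtain k where k: "map x [0..<k] \<in> \<Gamma> t" using t by (auto simp: live_def)
      obtain j where j: "map x [0..<j] \<in> E t" using E[OF x(2), of "to_nat t"] by auto
      obtain u where u: "map x [0..<max j k] = map x [0..<j] @ u"
        using map_upt_append[of j "max j k" x] by auto
      obtain u' where "map x [0..<max j k] = map x [0..<k] @ u'"
        using map_upt_append[of k "max j k" x] by auto
      then have "map x [0..<j] @ u \<in> \<Gamma> t" using u k \<Gamma>_up by metis
      with j show ?thesis by (auto simp: E_def live_def)
    qed
    then obtain A where A: "\<And>t. live t \<Longrightarrow> live (t @ [A t])" by metis
    \<comment> \<open>The words \<open>b k\<close> form a branch of live words; its limit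
      \<open>y\<close> is the desired witness for \<open>x\<close>.\<close>
    define b where "b = rec_nat [] (\<lambda>_ t. t @ [A t])"
    have b: "b 0 = []" "b (Suc k) = b k @ [A (b k)]" for k by (simp_all add: b_def)
    have len: "length (b k) = k" for k by (induction k) (simp_all add: b)
    have live_b: "live (b k)" for k by (induction k) (simp_all add: b live_Nil A)
    define y where "y i = b (Suc i) ! i" for i
    have y: "b k ! i = y i" if "i < k" for i k
      using that by (induction k) (auto simp: b y_def nth_append len less_Suc_eq)
    have "(x, y) \<in> C"
    proof (rule closed[unfolded limit_closed_def, rule_format])
      fix k
      obtain j where j: "map x [0..<j] \<in> \<Gamma> (b k)" using live_b by (auto simp: live_def)
      moreover obtain u where "map x [0..<max j k] = map x [0..<j] @ u"
        using map_upt_append[of j "max j k" x] by auto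
      ultimately have "\<not> meagre (U (b k) \<inter> cyl (map x [0..<max j k]))"
        by (simp add: \<Gamma>_def)
      \<comment> \<open>A nonmeagre set is nonempty, so points of \<open>C\<close> agree with the
        pair of \<open>x\<close> and \<open>y\<close> up to any given place, and closedness of
        \<open>C\<close> applies.\<close>
      then have "U (b k) \<inter> cyl (map x [0..<max j k]) \<noteq> {}" using meagre_empty by metis
      then obtain x' y' where "(x', y') \<in> C" "y' \<in> cyl (b k)" "x' \<in> cyl (map x [0..<max j k])"
        unfolding U_def by auto
      then show "\<exists>(x', y')\<in>C. \<forall>i<k. x' i = x i \<and> y' i = y i"
        by (intro bexI[of _ "(x', y')"]) (auto simp: cyl_def len y)
    qed
    then show ?thesis by force
  qed
  then show ?thesis by (rule large[OF n])
qed

section \<open>Intervals and almost disjoint families\<close>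

lemma closed_if_agree:
  fixes S :: "(nat \<Rightarrow> 'a::topological_space) set"
  assumes "closed S" and agree: "\<And>k. \<exists>y'\<in>S. \<forall>i<k. y' i = y i"
  shows "y \<in> S"
proof (rule ccontr)
  assume "y \<notin> S"
  moreover have "openin (product_topology (\<lambda>i. euclidean) UNIV) (- S)"
    using \<open>closed S\<close> by (simp flip: open_fun_def add: closed_open)
  ultimately obtain X where X: "y \<in> (\<Pi>\<^sub>E i\<in>UNIV. X i)" "finite {i. X i \<noteq> UNIV}"
    "(\<Pi>\<^sub>E i\<in>UNIV. X i) \<subseteq> - S"
    using product_topology_open_contains_basis[of "\<lambda>i. euclidean" UNIV "- S" y] by auto
  \<comment> \<open>A basic open neighbourhood restricts finitely many coordinates only, so
    agreement below \<open>k\<close> keeps \<open>y'\<close> inside it.\<close>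
  obtain k where k: "\<forall>i\<in>{i. X i \<noteq> UNIV}. i < k"
    using X(2) finite_nat_set_iff_bounded by blast
  obtain y' where y': "y' \<in> S" "\<forall>i<k. y' i = y i" using agree by blast
  have "y' i \<in> X i" for i
    using X(1) y'(2) k by (cases "X i = UNIV") (auto simp: PiE_iff)
  then show False using X(3) y'(1) by (auto simp: PiE_iff)
qed

lemma closed_Collect_eq_fun:
  fixes f g :: "'a::topological_space \<Rightarrow> 'i \<Rightarrow> 'b::t2_space"
  assumes "continuous_on UNIV f" "continuous_on UNIV g"
  shows "closed {u. f u = g u}"
proof -
  have "closed {u. f u i = g u i}" for i
    using closed_Collect_eq[OF assms[THEN continuous_on_product_then_coordinatewise]] .
  then show ?thesis unfolding fun_eq_iff by (rule closed_Collect_all)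
qed

text \<open>The graph of a continuous parametrization is closed, and the set is its projection. The
  equation defining the graph is split into coordinates because \<open>closed_Collect_eq_fun\<close>
  concerns maps with functions as values.\<close>

lemma analytic_set_projection:
  fixes A :: "((nat \<Rightarrow> nat) \<times> (nat \<Rightarrow> nat)) set"
  assumes "analytic_set A"
  obtains D :: "(((nat \<Rightarrow> nat) \<times> (nat \<Rightarrow> nat)) \<times> (nat \<Rightarrow> nat)) set"
    where "closed D" "A = fst ` D"
proof (cases "A = {}")
  case True
  then show ?thesis using that[of "{}"] by simp
next
  case False
  then obtain f :: "(nat \<Rightarrow> nat) \<Rightarrow> _" where f: "continuous_on UNIV f" "A = range f"
    using assms unfolding analytic_set_def by blast
  have fs: "continuous_on UNIV (\<lambda>u. f (snd u))"
    by (rule continuous_on_compose2[OF f(1) continuous_on_snd[OF continuous_on_id]]) auto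
  define D where "D = {u. fst (fst u) = fst (f (snd u))} \<inter> {u. snd (fst u) = snd (f (snd u))}"
  have "closed D"
    unfolding D_def by (intro closed_Int closed_Collect_eq_fun continuous_intros fs)
  moreover have "A = fst ` D"
  proof
    show "A \<subseteq> fst ` D"
    proof
      fix z assume "z \<in> A"
      then obtain y where "z = f y" using f(2) by blast
      then have "(z, y) \<in> D" by (simp add: D_def)
      then show "z \<in> fst ` D" by force
    qed
    show "fst ` D \<subseteq> A" unfolding f(2) D_def by (auto simp: prod_eq_iff)
  qed
  ultimately show ?thesis by (rule that)
qed

section \<open>Almost disjoint families of sets of natural numbers\<close>

lemma uncountable_sequences: "\<not> countable (UNIV :: (nat \<Rightarrow> bool) set)"
proof
  assume "countable (UNIV :: (nat \<Rightarrow> bool) set)"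
  then have "range (from_nat_into (UNIV :: (nat \<Rightarrow> bool) set)) = UNIV"
    by (intro range_from_nat_into UNIV_not_empty)
  then obtain f :: "nat \<Rightarrow> nat \<Rightarrow> bool" where f: "range f = UNIV" by blast
  then obtain k where "f k = (\<lambda>k. \<not> f k k)" by (metis surjD)
  then show False by meson
qed

text \<open>Each branch of the binary tree is represented by the codes of its initial segments. Two
  different branches share only the segments up to the place where they part.\<close>

lemma almost_disjoint_family:
  obtains B :: "(nat \<Rightarrow> bool) \<Rightarrow> nat set" where
    "\<And>\<beta>. infinite (B \<beta>)" "\<And>\<beta> \<gamma>. \<beta> \<noteq> \<gamma> \<Longrightarrow> finite (B \<beta> \<inter> B \<gamma>)"
proof -
  define code where "code \<beta> k = to_nat (map \<beta> [0..<k])" for \<beta> :: "nat \<Rightarrow> bool" and k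
  have code: "k = k' \<and> (\<forall>i<k. \<beta> i = \<gamma> i)" if "code \<beta> k = code \<gamma> k'" for \<beta> \<gamma> k k'
  proof -
    have eq: "map \<beta> [0..<k] = map \<gamma> [0..<k']" using that by (simp add: code_def)
    then have "k = k'" using map_eq_imp_length_eq by fastforce
    with eq show ?thesis by auto
  qed
  have "infinite (range (code \<beta>))" for \<beta>
    using code by (intro range_inj_infinite injI) blast
  moreover have "finite (range (code \<beta>) \<inter> range (code \<gamma>))" if "\<beta> \<noteq> \<gamma>" for \<beta> \<gamma>
  proof -
    obtain i where i: "\<beta> i \<noteq> \<gamma> i" using \<open>\<beta> \<noteq> \<gamma>\<close> by blast
    have "range (code \<beta>) \<inter> range (code \<gamma>) \<subseteq> code \<beta> ` {..i}"
    proof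
      fix l assume "l \<in> range (code \<beta>) \<inter> range (code \<gamma>)"
      then obtain k k' where "l = code \<beta> k" "l = code \<gamma> k'" by blast
      then show "l \<in> code \<beta> ` {..i}" using code[of \<beta> k \<gamma> k'] i by (metis atMost_iff image_eqI not_le)
    qed
    then show ?thesis using finite_subset by blast
  qed
  ultimately show ?thesis using that[of "\<lambda>\<beta>. range (code \<beta>)"] by blast
qed

section \<open>Interval partitions with prescribed patterns\<close>

lemma interval_unique:
  fixes n :: "nat \<Rightarrow> nat"
  assumes "strict_mono n" "n l \<le> k" "k < n (Suc l)" "n l' \<le> k" "k < n (Suc l')"
  shows "l = l'"
proof -
  have "n l < n (Suc l')" "n l' < n (Suc l)" using assms by linarith+
  then have "l < Suc l'" "l' < Suc l" using assms(1) strict_mono_less by blast+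
  then show ?thesis by simp
qed

text \<open>Dropping the second component of the decoded pair makes every finite set the label of
  infinitely many blocks. The label of a block lists the indices \<open>i\<close> for which the
  block is to be part of \<open>X i\<close>.\<close>

definition block_label :: "nat \<Rightarrow> nat set" where
  "block_label l = set_decode (fst (prod_decode l))"

lemma block_label_infinitely_often:
  assumes "finite F"
  shows "\<exists>\<^sub>\<infinity>l. block_label l = F"
  unfolding INFM_nat_le
proof
  fix t
  have "block_label (prod_encode (set_encode F, t)) = F"
    using assms by (simp add: block_label_def set_encode_inverse)
  then show "\<exists>l\<ge>t. block_label l = F" using le_prod_encode_2 by blast
qed

text \<open>On a block labelled by exactly the indices up to \<open>N\<close> where \<open>s\<close>
  is true, the pattern holds throughout, so the conjunction reduces to \<open>g\<close> there. Thus
  every cell of \<open>X\<close>, cut down by \<open>g\<close>, still matches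
  \<open>g\<close>.\<close>

lemma patterns_match:
  fixes n :: "nat \<Rightarrow> nat" and s :: "nat \<Rightarrow> bool"
  assumes "strict_mono n"
  defines "X \<equiv> \<lambda>i. \<Union>l\<in>{l. i \<in> block_label l}. {n l..<n (Suc l)}"
  shows "matches n g (\<lambda>k. (\<forall>i\<le>N. k \<in> X i \<longleftrightarrow> s i) \<and> g k)"
proof -
  have "\<exists>\<^sub>\<infinity>l. block_label l = {i. i \<le> N \<and> s i}"
    by (rule block_label_infinitely_often) simp
  then show ?thesis
    unfolding matches_def
  proof (rule INFM_mono)
    fix l assume l: "block_label l = {i. i \<le> N \<and> s i}"
    have "k \<in> X i \<longleftrightarrow> i \<in> block_label l" if "k \<in> {n l..<n (Suc l)}" for i k
      using that interval_unique[OF assms(1), of l k] by (auto simp: X_def)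
    then show "\<forall>k\<in>{n l..<n (Suc l)}. ((\<forall>i\<le>N. k \<in> X i \<longleftrightarrow> s i) \<and> g k) = g k"
      using l by simp
  qed
qed

text \<open>Past \<open>s\<close>, the sequence \<open>x \<beta>\<close> copies \<open>g\<close> on
  the blocks with index in \<open>B \<beta>\<close> and is true elsewhere. Two such sequences can be
  false together past \<open>s\<close> only in blocks common to both index sets, and these are
  finitely many.\<close>

lemma almost_codisjoint_family:
  fixes n :: "nat \<Rightarrow> nat"
  assumes n: "strict_mono n"
  shows "\<exists>x :: (nat \<Rightarrow> bool) \<Rightarrow> nat \<Rightarrow> bool. (\<forall>\<beta>. x \<beta> \<in> cyl s \<and> matches n g (x \<beta>)) \<and>
    (\<forall>\<beta> \<gamma>. \<beta> \<noteq> \<gamma> \<longrightarrow> (\<exists>M. \<forall>k\<ge>M. x \<beta> k \<or> x \<gamma> k))"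
proof -
  obtain B :: "(nat \<Rightarrow> bool) \<Rightarrow> nat set" where B: "\<And>\<beta>. infinite (B \<beta>)"
    "\<And>\<beta> \<gamma>. \<beta> \<noteq> \<gamma> \<Longrightarrow> finite (B \<beta> \<inter> B \<gamma>)"
    using almost_disjoint_family by metis
  define x where "x \<beta> k = (if k < length s then s ! k
    else \<forall>l\<in>B \<beta>. k \<in> {n l..<n (Suc l)} \<longrightarrow> g k)" for \<beta> k
  have "x \<beta> \<in> cyl s" for \<beta> by (simp add: cyl_def x_def)
  moreover have "matches n g (x \<beta>)" for \<beta>
    unfolding matches_def INFM_nat_le
  proof
    fix t
    \<comment> \<open>Since \<open>l \<le> n l\<close>, an index beyond the length of
      \<open>s\<close> puts the whole block past \<open>s\<close>.\<close>
    obtain l where l: "l \<in> B \<beta>" "l \<ge> max t (length s)"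
      using B(1)[of \<beta>] unfolding infinite_nat_iff_unbounded_le by blast
    have "x \<beta> k = g k" if k: "k \<in> {n l..<n (Suc l)}" for k
    proof -
      have "\<not> k < length s" using k l(2) strict_mono_imp_increasing[OF n, of l] by auto
      moreover have "(\<forall>l\<in>B \<beta>. k \<in> {n l..<n (Suc l)} \<longrightarrow> g k) = g k" using l(1) k by blast
      ultimately show ?thesis by (simp add: x_def)
    qed
    then show "\<exists>l\<ge>t. \<forall>k\<in>{n l..<n (Suc l)}. x \<beta> k = g k" using l(2) by (intro exI[of _ l]) auto
  qed
  moreover have "\<exists>M. \<forall>k\<ge>M. x \<beta> k \<or> x \<gamma> k" if "\<beta> \<noteq> \<gamma>" for \<beta> \<gamma>
  proof -
    obtain L where L: "\<forall>l\<in>B \<beta> \<inter> B \<gamma>. l < L"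
      using B(2)[OF \<open>\<beta> \<noteq> \<gamma>\<close>] finite_nat_set_iff_bounded by blast
    have "x \<beta> k \<or> x \<gamma> k" if k: "k \<ge> max (length s) (n L)" for k
    proof (rule ccontr)
      assume "\<not> (x \<beta> k \<or> x \<gamma> k)"
      then obtain l l' where l: "l \<in> B \<beta>" "k \<in> {n l..<n (Suc l)}" "l' \<in> B \<gamma>" "k \<in> {n l'..<n (Suc l')}"
        using k by (auto simp: x_def)
      then have "l = l'" using interval_unique[OF n, of l k l'] by simp
      then have "Suc l \<le> L" using L l by (simp add: Suc_le_eq)
      then have "n (Suc l) \<le> n L" using n by (simp add: strict_mono_less_eq)
      then show False using k l(2) by simp
    qed
    then show ?thesis by blast
  qed
  ultimately show ?thesis by (intro exI[of _ x]) simp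
qed

section \<open>The forcing relation\<close>

locale forcing =
  fixes P :: "('p, 'm) forcing_scheme" (structure)
  assumes forcing_notion: "forcing_notion P"
begin

definition below :: "'p \<Rightarrow> 'p set" where
  "below p = {q \<in> conds P. q \<preceq> p}"

definition densely :: "'p sentence \<Rightarrow> 'p sentence" where
  "densely \<phi> = (\<lambda>p. \<forall>q\<in>below p. \<exists>r\<in>below q. \<phi> r)"

definition persistent :: "'p sentence \<Rightarrow> bool" where
  "persistent \<phi> \<longleftrightarrow> (\<forall>p\<in>conds P. \<phi> p \<longrightarrow> (\<forall>q\<in>below p. \<phi> q))"

text \<open>The sets of conditions satisfying such a predicate are the regular open subsets of the
  order. Every sentence treated below has this form, which allows passing to stronger conditions and
  checking a sentence on a dense set only.\<close>

definition regular :: "'p sentence \<Rightarrow> bool" where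
  "regular \<phi> \<longleftrightarrow> persistent \<phi> \<and> (\<forall>p\<in>conds P. densely \<phi> p \<longrightarrow> \<phi> p)"

lemma maxel_conds: "maxel P \<in> conds P"
  using forcing_notion by (simp add: forcing_notion_def)

lemma le_maxel: "p \<in> conds P \<Longrightarrow> p \<preceq> maxel P"
  using forcing_notion by (simp add: forcing_notion_def)

lemma le_trans: "\<lbrakk>p \<preceq> q; q \<preceq> r; p \<in> conds P; q \<in> conds P; r \<in> conds P\<rbrakk> \<Longrightarrow> p \<preceq> r"
  using forcing_notion unfolding forcing_notion_def by blast

lemma below_conds: "q \<in> below p \<Longrightarrow> q \<in> conds P"
  by (simp add: below_def)

lemma below_refl: "p \<in> conds P \<Longrightarrow> p \<in> below p"
  using forcing_notion by (simp add: forcing_notion_def below_def)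

lemma below_trans: "\<lbrakk>r \<in> below q; q \<in> below p; p \<in> conds P\<rbrakk> \<Longrightarrow> r \<in> below p"
  unfolding below_def using le_trans by blast

lemma incompatible_iff:
  "incompatible P p q \<longleftrightarrow> below p \<inter> below q = {}"
  unfolding incompatible_def below_def by blast

lemma persistentD: "\<lbrakk>persistent \<phi>; \<phi> p; q \<in> below p; p \<in> conds P\<rbrakk> \<Longrightarrow> \<phi> q"
  unfolding persistent_def by blast

lemma regular_persistent: "regular \<phi> \<Longrightarrow> persistent \<phi>"
  by (simp add: regular_def)

lemma regular_mono: "\<lbrakk>\<phi> p; q \<in> below p; p \<in> conds P; regular \<phi>\<rbrakk> \<Longrightarrow> \<phi> q"
  unfolding regular_def persistent_def by blast

lemma regular_dense:
  "\<lbrakk>regular \<phi>; p \<in> conds P; \<And>q. q \<in> below p \<Longrightarrow> \<exists>r\<in>below q. \<phi> r\<rbrakk> \<Longrightarrow> \<phi> p"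
  unfolding regular_def densely_def by blast

lemma densely_iff: "\<lbrakk>regular \<phi>; p \<in> conds P\<rbrakk> \<Longrightarrow> densely \<phi> p \<longleftrightarrow> \<phi> p"
  unfolding regular_def persistent_def densely_def by (meson below_conds below_refl)

lemma denselyI: "(\<And>q. q \<in> below p \<Longrightarrow> \<exists>r\<in>below q. \<phi> r) \<Longrightarrow> densely \<phi> p"
  by (simp add: densely_def)

lemma denselyE:
  assumes "densely \<phi> p" "q \<in> below p"
  obtains r where "r \<in> below q" "\<phi> r"
  using assms by (auto simp: densely_def)

lemma denselyE_refl:
  assumes "densely \<phi> p" "p \<in> conds P"
  obtains r where "r \<in> below p" "\<phi> r"
  using assms below_refl by (auto simp: densely_def)

lemma densely_now:
  assumes "p \<in> conds P" "\<And>q. q \<in> below p \<Longrightarrow> \<phi> q"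
  shows "densely \<phi> p"
  using assms below_refl below_conds unfolding densely_def by meson

text \<open>Disjunctions and existential quantifiers, being negated conjunctions and universal
  statements of negations, unfold to density statements. They are therefore regular whatever their
  components are.\<close>

lemma regular_densely: "regular (densely \<phi>)"
  unfolding regular_def persistent_def
proof (intro conjI ballI impI)
  fix p q assume "p \<in> conds P" "densely \<phi> p" "q \<in> below p"
  then show "densely \<phi> q" unfolding densely_def using below_trans by blast
next
  fix p assume p: "p \<in> conds P" "densely (densely \<phi>) p"
  show "densely \<phi> p"
  proof (rule denselyI)
    fix q assume q: "q \<in> below p"
    with p obtain r where r: "r \<in> below q" "densely \<phi> r" by (auto elim: denselyE)
    then obtain s where "s \<in> below r" "\<phi> s" by (auto elim: denselyE_refl intro: below_conds)
    then show "\<exists>r\<in>below q. \<phi> r" using r q below_trans below_conds by blast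
  qed
qed

section \<open>Connectives and quantifiers as density statements\<close>

lemma fnot_iff: "(\<^bold>\<not> \<phi>) p \<longleftrightarrow> (\<forall>q\<in>below p. \<not> \<phi> q)"
  by (auto simp: fnot_def below_def)

lemma f_or_eq: "(\<phi> \<^bold>\<or> \<psi>) = densely (\<lambda>r. \<phi> r \<or> \<psi> r)"
  unfolding fun_eq_iff f_or_def fnot_def fand_def densely_def below_def by blast

lemma fex_eq: "fex P \<Phi> = densely (\<lambda>r. \<exists>a\<in>names P. \<Phi> a r)"
  unfolding fun_eq_iff fex_def fall_def fnot_def densely_def below_def by blast

lemma fex_in_eq: "fex_in P A \<Phi> = densely (\<lambda>r. \<exists>a\<in>names P. A a r \<and> \<Phi> a r)"
  by (simp add: fex_in_def fex_eq fand_def)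

lemma fex_ground_eq: "fex_ground P \<Phi> = densely (\<lambda>r. \<exists>x. \<Phi> x r)"
  unfolding fun_eq_iff fex_ground_def fnot_def densely_def below_def by blast

text \<open>Unfolding the negations yields \<open>\<psi>\<close> only somewhere below each condition
  that satisfies \<open>\<phi>\<close>. Persistence of \<open>\<phi>\<close> makes this hold
  densely, and regularity of \<open>\<psi>\<close> then gives \<open>\<psi>\<close> at the condition
  itself.\<close>

lemma fimp_iff:
  assumes "persistent \<phi>" "regular \<psi>" "p \<in> conds P"
  shows "(\<phi> \<^bold>\<longrightarrow> \<psi>) p \<longleftrightarrow> (\<forall>q\<in>below p. \<phi> q \<longrightarrow> \<psi> q)"
proof -
  have "(\<phi> \<^bold>\<longrightarrow> \<psi>) p \<longleftrightarrow> (\<forall>q\<in>below p. \<phi> q \<longrightarrow> (\<exists>r\<in>below q. \<psi> r))"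
    by (auto simp: fimp_def fnot_def fand_def below_def)
  also have "\<dots> \<longleftrightarrow> (\<forall>q\<in>below p. \<phi> q \<longrightarrow> \<psi> q)"
  proof (intro iffI ballI impI)
    fix q assume H: "\<forall>q\<in>below p. \<phi> q \<longrightarrow> (\<exists>r\<in>below q. \<psi> r)" and q: "q \<in> below p" "\<phi> q"
    show "\<psi> q"
    proof (rule regular_dense[OF assms(2)])
      fix r assume "r \<in> below q"
      then show "\<exists>s\<in>below r. \<psi> s"
        using H q assms below_trans persistentD below_conds by blast
    qed (use q below_conds in auto)
  qed (use below_refl below_conds in blast)
  finally show ?thesis .
qed

lemma fall_in_iff:
  assumes "\<And>a. a \<in> names P \<Longrightarrow> persistent (A a)" "\<And>a. a \<in> names P \<Longrightarrow> regular (\<Phi> a)"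
    and "p \<in> conds P"
  shows "fall_in P A \<Phi> p \<longleftrightarrow> (\<forall>a\<in>names P. \<forall>q\<in>below p. A a q \<longrightarrow> \<Phi> a q)"
  using assms by (simp add: fall_in_def fall_def fimp_iff)

lemma regular_fnot: "persistent \<phi> \<Longrightarrow> regular (\<^bold>\<not> \<phi>)"
  unfolding regular_def persistent_def densely_def fnot_iff
  by (meson below_conds below_refl below_trans)

lemma persistent_fand: "\<lbrakk>persistent \<phi>; persistent \<psi>\<rbrakk> \<Longrightarrow> persistent (\<phi> \<^bold>\<and> \<psi>)"
  by (simp add: persistent_def fand_def)

lemma regular_fand:
  assumes "regular \<phi>" "regular \<psi>"
  shows "regular (\<phi> \<^bold>\<and> \<psi>)"
  using assms persistent_fand[of \<phi> \<psi>] unfolding regular_def densely_def fand_def by meson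

lemma regular_fimp:
  assumes "persistent \<phi>" "regular \<psi>"
  shows "regular (\<phi> \<^bold>\<longrightarrow> \<psi>)"
  unfolding fimp_def using assms
  by (blast intro: regular_fnot persistent_fand regular_persistent)

lemma regular_fall: "(\<And>a. a \<in> names P \<Longrightarrow> regular (\<Phi> a)) \<Longrightarrow> regular (fall P \<Phi>)"
  unfolding regular_def persistent_def densely_def fall_def by meson

lemma regular_fall_in:
  assumes "\<And>a. a \<in> names P \<Longrightarrow> regular (A a)" "\<And>a. a \<in> names P \<Longrightarrow> regular (\<Phi> a)"
  shows "regular (fall_in P A \<Phi>)"
  using assms
  unfolding fall_in_def by (intro regular_fall regular_fimp regular_persistent)

section \<open>Equality and membership of names\<close>

lemma mem_eq_densely: "(a \<^bold>\<in> b) = densely (\<lambda>r. \<exists>(c, s)\<in>pairs b. r \<preceq> s \<and> (a \<^bold>= c) r)"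
  by (simp add: fun_eq_iff densely_def below_def forces_mem.simps[of P a b] Ball_def Bex_def
      conj_assoc imp_conjL)

lemma regular_mem: "regular (a \<^bold>\<in> b)"
  by (simp add: mem_eq_densely regular_densely)

lemma mem_iff: "(a \<^bold>\<in> b) p \<longleftrightarrow> densely (\<lambda>r. \<exists>(c, s)\<in>pairs b. r \<preceq> s \<and> (a \<^bold>= c) r) p"
  by (simp add: mem_eq_densely)

lemma eq_iff: "(a \<^bold>= b) p \<longleftrightarrow>
    (\<forall>(c, s)\<in>pairs a. \<forall>q\<in>below p. q \<preceq> s \<longrightarrow> (c \<^bold>\<in> b) q) \<and>
    (\<forall>(c, s)\<in>pairs b. \<forall>q\<in>below p. q \<preceq> s \<longrightarrow> (c \<^bold>\<in> a) q)"
  by (simp add: forces_eq.simps[of P a b p] below_def Ball_def imp_conjL)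

lemma eq_sym: "(a \<^bold>= b) p \<Longrightarrow> (b \<^bold>= a) p"
  unfolding eq_iff[of a b] eq_iff[of b a] by blast

lemma namesD: "\<lbrakk>a \<in> names P; (b, s) \<in> pairs a\<rbrakk> \<Longrightarrow> b \<in> names P \<and> s \<in> conds P"
  by (auto elim: names.cases)

lemma regular_eq:
  fixes a b :: "('i, 'p) name"
  assumes "a \<in> names P" "b \<in> names P"
  shows "regular (a \<^bold>= b)"
proof -
  \<comment> \<open>One of the two inclusions, for arbitrary names, so that symmetry supplies the
    other. It rests on the regularity of membership.\<close>
  have *: "(c \<^bold>\<in> b) q"
    if H: "densely (a \<^bold>= b) p" and c: "(c, s) \<in> pairs a" and q: "q \<in> below p" "q \<preceq> s"
      and p: "p \<in> conds P" and s: "s \<in> conds P" for a b :: "('i, 'p) name" and c s p q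
  proof (rule regular_dense[OF regular_mem])
    show "q \<in> conds P" using q below_conds by blast
    fix r assume r: "r \<in> below q"
    then have "r \<in> below p" using q p below_trans by blast
    then obtain t where t: "t \<in> below r" "(a \<^bold>= b) t" using H by (auto elim: denselyE)
    have "t \<in> below q" using t r q below_trans below_conds by blast
    then have "t \<preceq> s" using q s p le_trans unfolding below_def by blast
    then have "(c \<^bold>\<in> b) t" using t c below_refl below_conds unfolding eq_iff by blast
    then show "\<exists>r'\<in>below r. (c \<^bold>\<in> b) r'" using t by blast
  qed
  have sym: "densely (b \<^bold>= a) p" if "densely (a \<^bold>= b) p" for p
    using that eq_sym unfolding densely_def by blast
  show ?thesis
    unfolding regular_def persistent_def
  proof (intro conjI ballI impI)
    fix p q assume "p \<in> conds P" "(a \<^bold>= b) p" "q \<in> below p"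
    then show "(a \<^bold>= b) q" unfolding eq_iff using below_trans by blast
  next
    fix p assume "p \<in> conds P" "densely (a \<^bold>= b) p"
    then have "(c \<^bold>\<in> b) q" if "(c, s) \<in> pairs a" "q \<in> below p" "q \<preceq> s" for c s q
      using that assms namesD by (blast intro: *)
    moreover have "(c \<^bold>\<in> a) q" if "(c, s) \<in> pairs b" "q \<in> below p" "q \<preceq> s" for c s q
      using that assms namesD sym \<open>p \<in> conds P\<close> \<open>densely (a \<^bold>= b) p\<close> by (blast intro: *)
    ultimately show "(a \<^bold>= b) p" unfolding eq_iff by blast
  qed
qed

lemma eq_refl: "a \<in> names P \<Longrightarrow> p \<in> conds P \<Longrightarrow> (a \<^bold>= a) p"
proof (induction a arbitrary: p rule: wf_induct_rule[OF wf_child_rel])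
  case (1 a)
  have "(c \<^bold>\<in> a) q" if c: "(c, s) \<in> pairs a" and q: "q \<in> below p" "q \<preceq> s" for c s q
    unfolding mem_iff
  proof (rule denselyI)
    fix r assume r: "r \<in> below q"
    have "s \<in> conds P" "c \<in> names P" using c 1 namesD by blast+
    moreover have "r \<in> conds P" "q \<in> conds P" using r q below_conds by blast+
    ultimately have "r \<preceq> s"
      using r q le_trans by (auto simp: below_def)
    moreover have "(c \<^bold>= c) r"
      using 1(1)[of c r] c \<open>c \<in> names P\<close> \<open>r \<in> conds P\<close> by (auto simp: child_rel_def)
    ultimately
     show "\<exists>r\<in>below r. \<exists>(d, s)\<in>pairs a. r \<preceq> s \<and> (c \<^bold>= d) r"
      using c below_refl \<open>r \<in> conds P\<close> by blast
  qed
  then show ?case unfolding eq_iff[of a a] by blast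
qed

text \<open>Transitivity of equality enters as an assumption about the members of \<open>a\<close>
  and \<open>b\<close> only. In this form the lemma is available inside the induction that proves
  \<open>eq_trans\<close>.\<close>

lemma eq_mem:
  assumes "(a \<^bold>= b) p" "p \<in> conds P" "(c \<^bold>\<in> a) p"
    and trans: "\<And>d e s t r. \<lbrakk>(d, s) \<in> pairs a; (e, t) \<in> pairs b; r \<in> conds P; (c \<^bold>= d) r; (d \<^bold>= e) r\<rbrakk>
      \<Longrightarrow> (c \<^bold>= e) r"
    and "c \<in> names P" "a \<in> names P"
  shows "(c \<^bold>\<in> b) p"
  unfolding mem_iff
proof (rule denselyI)
  fix q assume q: "q \<in> below p"
  then obtain r d s where r: "r \<in> below q" "(d, s) \<in> pairs a" "r \<preceq> s" "(c \<^bold>= d) r"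
    using assms(3) unfolding mem_iff by (auto elim: denselyE)
  have rp: "r \<in> below p" "r \<in> conds P" using q r assms(2) below_trans below_conds by blast+
  then have "(d \<^bold>\<in> b) r" using assms(1) r unfolding eq_iff by blast
  then obtain t e u where t: "t \<in> below r" "(e, u) \<in> pairs b" "t \<preceq> u" "(d \<^bold>= e) t"
    using rp unfolding mem_iff by (auto elim: denselyE_refl)
  have "(c \<^bold>= d) t"
    using r t rp assms namesD by (blast intro: regular_mono[OF _ _ _ regular_eq])
  with t r have "(c \<^bold>= e) t" by (blast intro: trans below_conds)
  then show "\<exists>r\<in>below q. \<exists>(e, s)\<in>pairs b. r \<preceq> s \<and> (c \<^bold>= e) r"
    using t r q below_trans below_conds by blast
qed

text \<open>Induction on \<open>a\<close> alone suffices: one inclusion starts from a child of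
  \<open>a\<close>, and for the other the chain of equalities is reversed by symmetry so that it
  starts from a child of \<open>a\<close> again.\<close>

lemma eq_trans:
  "\<lbrakk>(a \<^bold>= b) p; (b \<^bold>= c) p; p \<in> conds P; a \<in> names P; b \<in> names P; c \<in> names P\<rbrakk> \<Longrightarrow> (a \<^bold>= c) p"
proof (induction a arbitrary: b c p rule: wf_induct_rule[OF wf_child_rel])
  case (1 a)
  have IH: "(d \<^bold>= f) r" if "(d, s) \<in> pairs a" "(d \<^bold>= e) r" "(e \<^bold>= f) r" "r \<in> conds P"
    "e \<in> names P" "f \<in> names P" for d e f s r
    using 1(1)[of d e r f] that namesD[OF \<open>a \<in> names P\<close>] by (auto simp: child_rel_def)
  note n = \<open>a \<in> names P\<close> \<open>b \<in> names P\<close> \<open>c \<in> names P\<close>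
  have "(d \<^bold>\<in> c) q" if d: "(d, s) \<in> pairs a" and q: "q \<in> below p" "q \<preceq> s" for d s q
  proof (rule eq_mem[of b c q d])
    show "(d \<^bold>\<in> b) q" using d q 1(2) unfolding eq_iff[of a b] by blast
    show "(b \<^bold>= c) q" using regular_mono[OF 1(3) q(1) 1(4) regular_eq] n by blast
    show "(d \<^bold>= f) r" if "(e, t) \<in> pairs b" "(f, u) \<in> pairs c" "r \<in> conds P" "(d \<^bold>= e) r"
      "(e \<^bold>= f) r" for e f t u r
      using IH[OF d] that n namesD by blast
  qed (use q below_conds d n namesD in blast)+
  moreover
  have "(d \<^bold>\<in> a) q" if d: "(d, s) \<in> pairs c" and q: "q \<in> below p" "q \<preceq> s" for d s q
  proof (rule eq_mem[of b a q d])
    show "(d \<^bold>\<in> b) q" using d q 1(3) unfolding eq_iff[of b c] by blast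
    show "(b \<^bold>= a) q" using regular_mono[OF eq_sym[OF 1(2)] q(1) 1(4) regular_eq] n by blast
    show "(d \<^bold>= f) r" if "(e, t) \<in> pairs b" and f: "(f, u) \<in> pairs a" and "r \<in> conds P"
      and "(d \<^bold>= e) r" "(e \<^bold>= f) r" for e f t u r
    proof (rule eq_sym, rule IH[OF f])
      show "(f \<^bold>= e) r" "(e \<^bold>= d) r" using that eq_sym by blast+
    qed (use that n d namesD in blast)+
  qed (use q below_conds d n namesD in blast)+
  ultimately show ?case unfolding eq_iff[of a c] by blast
qed

lemma mem_eq:
  assumes "(c \<^bold>\<in> a) p" "(a \<^bold>= b) p" "p \<in> conds P" "a \<in> names P" "b \<in> names P" "c \<in> names P"
  shows "(c \<^bold>\<in> b) p"
  using assms by (intro eq_mem[of a b p c]) (auto intro: eq_trans dest: namesD)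

lemma eq_mem_left:
  assumes "(c \<^bold>= d) p" "(c \<^bold>\<in> a) p" "p \<in> conds P" "a \<in> names P" "d \<in> names P" "c \<in> names P"
  shows "(d \<^bold>\<in> a) p"
  unfolding mem_iff
proof (rule denselyI)
  fix q assume q: "q \<in> below p"
  then obtain r e s where r: "r \<in> below q" "(e, s) \<in> pairs a" "r \<preceq> s" "(c \<^bold>= e) r"
    using assms(2) unfolding mem_iff by (auto elim: denselyE)
  have rp: "r \<in> below p" "r \<in> conds P" using q r assms below_trans below_conds by blast+
  then have "(c \<^bold>= d) r" using assms regular_mono regular_eq by blast
  then have "(d \<^bold>= e) r" using rp r assms namesD eq_sym eq_trans by blast
  then show "\<exists>r\<in>below q. \<exists>(e, s)\<in>pairs a. r \<preceq> s \<and> (d \<^bold>= e) r" using r by blast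
qed

subsection \<open>Canonical names\<close>

lemma densely_cong: "(\<And>r. r \<in> conds P \<Longrightarrow> \<phi> r \<longleftrightarrow> \<psi> r) \<Longrightarrow> densely \<phi> p \<longleftrightarrow> densely \<psi> p"
  unfolding densely_def using below_conds by meson

lemma densely_mono:
  assumes "densely \<phi> p" "p \<in> conds P" "\<And>r. r \<in> below p \<Longrightarrow> \<phi> r \<Longrightarrow> \<psi> r"
  shows "densely \<psi> p"
  using assms below_trans unfolding densely_def by meson

lemma regular_densely_dest:
  assumes "densely \<phi> p" "p \<in> conds P" "regular \<psi>" "\<And>r. r \<in> below p \<Longrightarrow> \<phi> r \<Longrightarrow> \<psi> r"
  shows "\<psi> p"
  using densely_mono[OF assms(1,2,4)] densely_iff[OF assms(3,2)] by simp

lemma regular_fex: "regular (fex P \<Phi>)"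
  by (simp add: fex_eq regular_densely)

lemma regular_fex_in: "regular (fex_in P A \<Phi>)"
  by (simp add: fex_in_eq regular_densely)

lemma regular_f_or: "regular (\<phi> \<^bold>\<or> \<psi>)"
  by (simp add: f_or_eq regular_densely)

lemma regular_in_value: "regular (in_value P k X i)"
  by (simp add: in_value_def regular_fex)

lemma regular_in_omega: "regular (in_omega P k)"
  by (simp add: in_omega_def regular_mem)

lemmas regular_intros = regular_fex regular_fex_in regular_f_or regular_in_value regular_in_omega
  regular_mem regular_eq regular_fall regular_fall_in regular_fand regular_fimp regular_fnot
  regular_persistent

text \<open>The choices are made successively below \<open>p\<close>, and regularity preserves the
  earlier ones. The resulting function \<open>h\<close> lies in the ground model, so finite
  combinatorics there can be applied to it.\<close>

lemma simultaneously_decide: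
  assumes "finite I" "p \<in> conds P" and regular: "\<And>i j. i \<in> I \<Longrightarrow> regular (\<Phi> i j)"
    and "\<And>i. i \<in> I \<Longrightarrow> densely (\<lambda>r. \<exists>j. \<Phi> i j r) p"
  shows "\<exists>r\<in>below p. \<exists>h. \<forall>i\<in>I. \<Phi> i (h i) r"
  using assms
proof (induction I rule: finite_induct)
  case empty
  then show ?case using below_refl by blast
next
  case (insert i I)
  then obtain q h where q: "q \<in> below p" "\<forall>i\<in>I. \<Phi> i (h i) q" by auto
  from insert.prems(3)[of i] q(1) obtain r j where r: "r \<in> below q" "\<Phi> i j r"
    by (auto elim: denselyE)
  have "\<Phi> i' (h i') r" if "i' \<in> I" for i'
    using q r that insert.prems(2)[of i'] below_conds by (blast intro: regular_mono)
  then have "\<forall>i'\<in>insert i I. \<Phi> i' ((h(i := j)) i') r" using r insert.hyps by auto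
  then show ?case using r q insert.prems below_trans by blast
qed

text \<open>All canonical names have this form, so their members are computed by the single rule
  \<open>mem_set_name\<close>. Countability appears throughout because \<open>pairs_mk_name\<close>
  covers countable sets of pairs.\<close>

definition set_name :: "('i::infinite, 'p) name set \<Rightarrow> ('i, 'p) name" where
  "set_name C = mk_name ((\<lambda>c. (c, maxel P)) ` C)"

lemma pairs_set_name: "countable C \<Longrightarrow> pairs (set_name C) = (\<lambda>c. (c, maxel P)) ` C"
  unfolding set_name_def by (rule pairs_mk_name) auto

lemma set_name_names:
  assumes "countable C" "C \<subseteq> names P"
  shows "set_name C \<in> names P"
  by (rule names.intros) (use assms maxel_conds in \<open>auto simp: pairs_set_name\<close>)

lemma mem_set_name:
  assumes "countable C"
  shows "(x \<^bold>\<in> set_name C) p \<longleftrightarrow> densely (\<lambda>r. \<exists>c\<in>C. (x \<^bold>= c) r) p"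
  unfolding mem_iff by (rule densely_cong) (auto simp: pairs_set_name[OF assms] le_maxel)

lemma mem_set_nameI:
  assumes "c \<in> C" "countable C" "C \<subseteq> names P" "p \<in> conds P"
  shows "(c \<^bold>\<in> set_name C) p"
  unfolding mem_set_name[OF assms(2)]
  by (rule densely_now) (use assms eq_refl below_conds in blast)+

lemma check_nat_eq: "check_nat P n = set_name (check_nat P ` {..<n})"
  by (subst check_nat.simps) (simp add: set_name_def image_image)

lemma check_set_eq: "check_set P x = set_name (check_nat P ` x)"
  by (simp add: check_set_def set_name_def image_image)

lemma pair_name_eq: "pair_name P a b = set_name {set_name {a}, set_name {a, b}}"
  by (simp add: pair_name_def set_name_def)

lemma check_seq_eq:
  "check_seq P X = set_name (range (\<lambda>n. pair_name P (check_nat P n) (check_set P (X n))))"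
  by (simp add: check_seq_def set_name_def image_image)

lemma check_nat_names: "check_nat P n \<in> names P"
  by (induction n rule: less_induct) (subst check_nat_eq, auto intro!: set_name_names)

lemma check_set_names: "check_set P x \<in> names P"
  unfolding check_set_eq by (rule set_name_names) (auto simp: check_nat_names)

lemma pair_name_names: "\<lbrakk>a \<in> names P; b \<in> names P\<rbrakk> \<Longrightarrow> pair_name P a b \<in> names P"
  unfolding pair_name_eq by (intro set_name_names) (auto intro: set_name_names)

lemma mem_check_nat: "(x \<^bold>\<in> check_nat P n) p \<longleftrightarrow> densely (\<lambda>r. \<exists>m<n. (x \<^bold>= check_nat P m) r) p"
  by (subst check_nat_eq, subst mem_set_name) (auto intro!: densely_cong)

lemma mem_check_set: "(x \<^bold>\<in> check_set P y) p \<longleftrightarrow> densely (\<lambda>r. \<exists>m\<in>y. (x \<^bold>= check_nat P m) r) p"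
  unfolding check_set_eq by (subst mem_set_name) (auto intro!: densely_cong)

lemma mem_omega: "(x \<^bold>\<in> omega_name P) p \<longleftrightarrow> densely (\<lambda>r. \<exists>m. (x \<^bold>= check_nat P m) r) p"
  unfolding omega_name_def mem_check_set by simp

lemma mem_check_natI: "\<lbrakk>m < n; p \<in> conds P\<rbrakk> \<Longrightarrow> (check_nat P m \<^bold>\<in> check_nat P n) p"
  unfolding check_nat_eq[of n] by (rule mem_set_nameI) (auto simp: check_nat_names)

lemma mem_check_setI: "\<lbrakk>m \<in> x; p \<in> conds P\<rbrakk> \<Longrightarrow> (check_nat P m \<^bold>\<in> check_set P x) p"
  unfolding check_set_eq by (rule mem_set_nameI) (auto simp: check_nat_names)

text \<open>If \<open>n\<close> were a member of itself, some stronger condition would identify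
  \<open>n\<close> with some \<open>m < n\<close>; as \<open>m\<close> is a member of
  \<open>n\<close>, it would be a member of itself. This is what separates the names of different
  numbers.\<close>

lemma not_mem_self: "p \<in> conds P \<Longrightarrow> \<not> (check_nat P n \<^bold>\<in> (check_nat P n :: ('i::infinite, 'p) name)) p"
proof (induction n arbitrary: p rule: less_induct)
  case (less n)
  let ?c = "check_nat P :: nat \<Rightarrow> ('i, 'p) name"
  show ?case
  proof
    assume "(?c n \<^bold>\<in> ?c n) p"
    then obtain r where r: "r \<in> below p" "\<exists>m<n. (?c n \<^bold>= ?c m) r"
      unfolding mem_check_nat using less.prems by (rule denselyE_refl)
    then obtain m where m: "m < n" "(?c n \<^bold>= ?c m) r" by blast
    have rc: "r \<in> conds P" using r(1) by (rule below_conds)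
    have "(?c m \<^bold>\<in> ?c m) r"
      using mem_eq[OF mem_check_natI[OF m(1) rc] m(2) rc] check_nat_names by blast
    then show False using less.IH[OF m(1) rc] by contradiction
  qed
qed

lemma check_nat_inj:
  assumes "(check_nat P n \<^bold>= (check_nat P m :: ('i::infinite, 'p) name)) p" "p \<in> conds P"
  shows "n = m"
proof -
  let ?c = "check_nat P :: nat \<Rightarrow> ('i, 'p) name"
  have *: False if "(?c n \<^bold>= ?c m) p" "n < m" for n m
    using mem_eq[OF mem_check_natI[OF that(2) assms(2)] eq_sym[OF that(1)] assms(2)]
      check_nat_names not_mem_self[OF assms(2)] by blast
  show ?thesis using *[of n m] *[of m n] eq_sym[OF assms(1)] assms(1) by (meson linorder_neqE_nat)
qed

lemma check_nat_mem_check_set: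
  assumes "p \<in> conds P"
  shows "(check_nat P n \<^bold>\<in> (check_set P x :: ('i::infinite, 'p) name)) p \<longleftrightarrow> n \<in> x"
proof
  let ?c = "check_nat P :: nat \<Rightarrow> ('i, 'p) name"
  assume "(?c n \<^bold>\<in> check_set P x) p"
  then obtain r where "r \<in> below p" "\<exists>m\<in>x. (?c n \<^bold>= ?c m) r"
    unfolding mem_check_set using assms by (rule denselyE_refl)
  then show "n \<in> x" using check_nat_inj below_conds by blast
qed (simp add: assms mem_check_setI)

lemma mem_singleton:
  assumes "a \<in> names P" "x \<in> names P" "p \<in> conds P"
  shows "(x \<^bold>\<in> set_name {a}) p \<longleftrightarrow> (x \<^bold>= a) p"
  by (subst mem_set_name) (use assms densely_iff[OF regular_eq, of x a p] in auto)

lemma mem_doubleton: "(x \<^bold>\<in> set_name {a, b}) p \<longleftrightarrow> densely (\<lambda>r. (x \<^bold>= a) r \<or> (x \<^bold>= b) r) p"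
  by (subst mem_set_name) auto

lemma mem_set_name_eq:
  assumes "(c \<^bold>= d) p" "d \<in> D" "countable D" "D \<subseteq> names P" "c \<in> names P" "p \<in> conds P"
  shows "(c \<^bold>\<in> set_name D) p"
  using eq_mem_left[OF eq_sym[OF assms(1)] mem_set_nameI[OF assms(2,3,4,6)] assms(6)]
    set_name_names[OF assms(3,4)] assms by blast

lemma set_name_cong:
  fixes C D :: "('i::infinite, 'p) name set"
  assumes "countable C" "countable D" "C \<subseteq> names P" "D \<subseteq> names P" "p \<in> conds P"
    and "\<And>c. c \<in> C \<Longrightarrow> \<exists>d\<in>D. (c \<^bold>= d) p" "\<And>d. d \<in> D \<Longrightarrow> \<exists>c\<in>C. (d \<^bold>= c) p"
  shows "(set_name C \<^bold>= set_name D) p"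
proof -
  have eq: "(c \<^bold>= d) q" if "(c \<^bold>= d) p" "q \<in> below p" "c \<in> names P" "d \<in> names P"
    for c d :: "('i, 'p) name" and q
    using regular_mono[OF that(1,2) assms(5) regular_eq] that by blast
  have "(c \<^bold>\<in> set_name D) q" if c: "c \<in> C" "q \<in> below p" for c q
  proof -
    obtain d where "d \<in> D" "(c \<^bold>= d) p" using assms(6) c by blast
    then show ?thesis
      using eq[of c d q] c assms(1-4) below_conds by (intro mem_set_name_eq[of c d]) auto
  qed
  moreover have "(d \<^bold>\<in> set_name C) q" if d: "d \<in> D" "q \<in> below p" for d q
  proof -
    obtain c where "c \<in> C" "(d \<^bold>= c) p" using assms(7) d by blast
    then show ?thesis
      using eq[of d c q] d assms(1-4) below_conds by (intro mem_set_name_eq[of d c]) auto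
  qed
  ultimately show ?thesis
    unfolding eq_iff[of "set_name C"] pairs_set_name[OF assms(1)] pairs_set_name[OF assms(2)]
    by simp
qed

section \<open>Kuratowski pairs in the extension\<close>

lemma pair_cong:
  assumes "(a \<^bold>= c) p" "(b \<^bold>= d) p" "p \<in> conds P"
    and "a \<in> names P" "b \<in> names P" "c \<in> names P" "d \<in> names P"
  shows "(pair_name P a b \<^bold>= pair_name P c d) p"
proof -
  have "(set_name {a} \<^bold>= set_name {c}) p" "(set_name {a, b} \<^bold>= set_name {c, d}) p"
    by (rule set_name_cong; use assms in \<open>auto intro: eq_sym\<close>)+
  moreover have "set_name {a} \<in> names P" "set_name {a, b} \<in> names P"
    "set_name {c} \<in> names P" "set_name {c, d} \<in> names P"
    using assms by (auto intro!: set_name_names)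
  ultimately show ?thesis
    unfolding pair_name_eq by (intro set_name_cong) (use assms(3) in \<open>auto intro: eq_sym\<close>)
qed

text \<open>The singleton of \<open>a\<close> is densely equal to one of two sets containing
  \<open>c\<close>, which identifies \<open>a\<close> with \<open>c\<close>. The doubleton gives
  only an alternative for \<open>b\<close>; \<open>pair_eq_iff\<close> resolves it.\<close>

lemma pair_eqD:
  assumes eq: "(pair_name P a b \<^bold>= pair_name P c d) p" and p: "p \<in> conds P"
    and n: "a \<in> names P" "b \<in> names P" "c \<in> names P" "d \<in> names P"
  shows "(a \<^bold>= c) p" "densely (\<lambda>r. (b \<^bold>= c) r \<or> (b \<^bold>= d) r) p"
proof -
  let ?A = "set_name {a}" and ?B = "set_name {a, b}" and ?C = "set_name {c}" and ?D = "set_name {c, d}"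
  have N: "?A \<in> names P" "?B \<in> names P" "?C \<in> names P" "?D \<in> names P"
    using n by (auto intro!: set_name_names)
  have mem: "(x \<^bold>\<in> pair_name P c d) p" if "x \<in> {?A, ?B}" for x
  proof (rule mem_eq[OF _ eq p])
    show "(x \<^bold>\<in> pair_name P a b) p"
      unfolding pair_name_eq by (rule mem_set_nameI) (use that N p in auto)
  qed (use that n N pair_name_names in auto)
  have split: "densely (\<lambda>r. (x \<^bold>= ?C) r \<or> (x \<^bold>= ?D) r) p" if "x \<in> {?A, ?B}" for x
    using mem[OF that] unfolding pair_name_eq mem_doubleton .
  show "(a \<^bold>= c) p"
  proof (rule regular_densely_dest[OF split[of ?A] p regular_eq])
    fix r assume r: "r \<in> below p" and "(?A \<^bold>= ?C) r \<or> (?A \<^bold>= ?D) r"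
    moreover have rc: "r \<in> conds P" using r by (rule below_conds)
    moreover have "(c \<^bold>\<in> ?C) r" "(c \<^bold>\<in> ?D) r"
      by (rule mem_set_nameI; use n rc in auto)+
    ultimately have "(c \<^bold>\<in> ?A) r" using N n mem_eq eq_sym by blast
    then show "(a \<^bold>= c) r" using mem_singleton[OF n(1,3) rc] eq_sym by blast
  qed (use n in auto)
  show "densely (\<lambda>r. (b \<^bold>= c) r \<or> (b \<^bold>= d) r) p"
  proof (rule regular_densely_dest[OF split[of ?B] p regular_densely])
    fix r assume r: "r \<in> below p" and *: "(?B \<^bold>= ?C) r \<or> (?B \<^bold>= ?D) r"
    have rc: "r \<in> conds P" using r by (rule below_conds)
    have b: "(b \<^bold>\<in> ?B) r" by (rule mem_set_nameI) (use n rc in auto)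
    from * show "densely (\<lambda>r. (b \<^bold>= c) r \<or> (b \<^bold>= d) r) r"
    proof
      assume "(?B \<^bold>= ?C) r"
      then have "(b \<^bold>\<in> ?C) r" by (rule mem_eq[OF b]) (use N n rc in auto)
      then have "(b \<^bold>= c) r" using mem_singleton[OF n(3,2) rc] by blast
      then show ?thesis
        by (intro densely_now[OF rc] disjI1) (rule regular_mono[OF _ _ rc regular_eq[OF n(2,3)]])
    next
      assume "(?B \<^bold>= ?D) r"
      then have "(b \<^bold>\<in> ?D) r" by (rule mem_eq[OF b]) (use N n rc in auto)
      then show ?thesis unfolding mem_doubleton .
    qed
  qed (rule insertI2, rule insertI1)
qed

lemma pair_eq_iff:
  assumes "p \<in> conds P" "a \<in> names P" "b \<in> names P" "c \<in> names P" "d \<in> names P"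
  shows "(pair_name P a b \<^bold>= pair_name P c d) p \<longleftrightarrow> (a \<^bold>= c) p \<and> (b \<^bold>= d) p"
proof safe
  assume eq: "(pair_name P a b \<^bold>= pair_name P c d) p"
  show ac: "(a \<^bold>= c) p" using pair_eqD(1)[OF eq] assms by blast
  show "(b \<^bold>= d) p"
  proof (rule regular_densely_dest[OF pair_eqD(2)[OF eq] _ regular_eq])
    fix r assume r: "r \<in> below p" and "(b \<^bold>= c) r \<or> (b \<^bold>= d) r"
    then show "(b \<^bold>= d) r"
    proof (elim disjE)
      \<comment> \<open>In this case the reversed equality of pairs says that \<open>d\<close> is
        densely \<open>a\<close> or \<open>b\<close>, and both are equal to \<open>c\<close>
        already.\<close>
      assume bc: "(b \<^bold>= c) r"
      have acr: "(a \<^bold>= c) r" using ac r assms regular_mono[OF _ _ _ regular_eq] by blast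
      have rc: "r \<in> conds P" using r below_conds by blast
      have "(pair_name P c d \<^bold>= pair_name P a b) r"
        using eq r assms regular_mono[OF _ _ _ regular_eq] pair_name_names eq_sym by blast
      from pair_eqD(2)[OF this] show ?thesis
      proof (rule regular_densely_dest[OF _ rc regular_eq])
        fix s assume s: "s \<in> below r" and *: "(d \<^bold>= a) s \<or> (d \<^bold>= b) s"
        have "(b \<^bold>= c) s" "(a \<^bold>= c) s"
          using bc acr rc s assms regular_mono[OF _ _ _ regular_eq] by blast+
        then show "(b \<^bold>= d) s" using * s below_conds assms by (meson eq_sym eq_trans)
      qed (use rc assms in auto)
    qed
  qed (use assms in auto)
qed (use assms pair_cong in blast)

subsection \<open>Infinite sets and prompt splitting in the extension\<close>

lemma regular_conj_const:
  assumes "regular \<phi>"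
  shows "regular (\<lambda>p. b \<and> \<phi> p)"
proof (cases b)
  case False
  then show ?thesis using below_refl unfolding regular_def persistent_def densely_def by blast
qed (use assms in simp)

lemma regular_is_fun:
  assumes "\<And>x. x \<in> names P \<Longrightarrow> regular (A x)"
  shows "regular (is_fun P f A B)"
  unfolding is_fun_def by (intro regular_intros assms)

lemma is_fun_unique:
  assumes "is_fun P f A B p" "p \<in> conds P" "q \<in> below p"
    and "(pair_name P x y \<^bold>\<in> f) q" "(pair_name P x y' \<^bold>\<in> f) q"
    and "x \<in> names P" "y \<in> names P" "y' \<in> names P"
  shows "(y \<^bold>= y') q"
proof -
  have "(pair_name P x y \<^bold>\<in> f \<^bold>\<and> pair_name P x y' \<^bold>\<in> f \<^bold>\<longrightarrow> y \<^bold>= y') p"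
    using assms(1,6-8) unfolding is_fun_def fand_def fall_def by blast
  then have "\<forall>q\<in>below p. (pair_name P x y \<^bold>\<in> f \<^bold>\<and> pair_name P x y' \<^bold>\<in> f) q \<longrightarrow> (y \<^bold>= y') q"
    by (subst (asm) fimp_iff) (use assms in \<open>auto intro!: regular_persistent regular_fand
        regular_mem regular_eq\<close>)
  then show ?thesis using assms(3-5) unfolding fand_def by blast
qed

lemma is_fun_total:
  assumes "is_fun P f A B p" "p \<in> conds P" "q \<in> below p" "A x q" "x \<in> names P"
    and "\<And>x. x \<in> names P \<Longrightarrow> regular (A x)"
  shows "densely (\<lambda>r. \<exists>y\<in>names P. B y r \<and> (pair_name P x y \<^bold>\<in> f) r) q"
proof -
  have "fall_in P A (\<lambda>x. fex_in P B (\<lambda>y. pair_name P x y \<^bold>\<in> f)) p"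
    using assms(1) unfolding is_fun_def fand_def by blast
  then show ?thesis
    using assms
    by (subst (asm) fall_in_iff) (auto simp: fex_in_eq intro: regular_persistent regular_densely)
qed

lemma is_bij_onto:
  assumes "is_bij P f A B p" "p \<in> conds P" "q \<in> below p" "B y q" "y \<in> names P"
    and "\<And>y. y \<in> names P \<Longrightarrow> regular (B y)"
  shows "densely (\<lambda>r. \<exists>x\<in>names P. A x r \<and> (pair_name P x y \<^bold>\<in> f) r) q"
proof -
  have "fall_in P B (\<lambda>y. fex_in P A (\<lambda>x. pair_name P x y \<^bold>\<in> f)) p"
    using assms(1) unfolding is_bij_def fand_def by blast
  then show ?thesis
    using assms
    by (subst (asm) fall_in_iff) (auto simp: fex_in_eq intro: regular_persistent regular_densely)
qed

text \<open>Pigeonhole principle in the extension: a bijection from \<open>N\<close> would have to hit \<open>N + 1\<close>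
  decided members of the class.\<close>

lemma is_infinite_if_unbounded:
  fixes A :: "('i::infinite, 'p) name \<Rightarrow> 'p sentence"
  assumes p: "p \<in> conds P" and A: "\<And>x. x \<in> names P \<Longrightarrow> regular (A x)"
    and unbounded: "\<And>q m. q \<in> below p \<Longrightarrow> \<exists>n\<ge>m. \<exists>r\<in>below q. A (check_nat P n) r"
  shows "is_infinite P A p"
  unfolding is_infinite_def fnot_iff
proof (intro ballI notI)
  let ?c = "check_nat P :: nat \<Rightarrow> ('i, 'p) name"
  fix q assume q: "q \<in> below p"
    and "fex_in P (in_omega P) (\<lambda>n. fex P (\<lambda>f. is_bij P f (\<lambda>i. i \<^bold>\<in> n) A)) q"
  then obtain r n where r: "r \<in> below q" and n: "n \<in> names P" "(n \<^bold>\<in> omega_name P) r"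
    and ex_f: "fex P (\<lambda>f. is_bij P f (\<lambda>i. i \<^bold>\<in> n) A) r"
    unfolding fex_in_eq in_omega_def densely_def using below_refl below_conds by blast
  have rc: "r \<in> conds P" using r by (rule below_conds)
  obtain r1 where r1: "r1 \<in> below r" "\<exists>N. (n \<^bold>= ?c N) r1"
    using n(2) rc unfolding mem_omega by (rule denselyE_refl)
  then obtain N where N: "(n \<^bold>= ?c N) r1" by blast
  obtain r2 f where r2: "r2 \<in> below r1" and f: "f \<in> names P" "is_bij P f (\<lambda>i. i \<^bold>\<in> n) A r2"
    using ex_f r1(1) unfolding fex_eq densely_def by blast
  have conds: "q \<in> conds P" "r1 \<in> conds P" "r2 \<in> conds P" using q r1(1) r2 below_conds by blast+
  have r2p: "r2 \<in> below p" using r2 r1(1) r q p conds rc below_trans by blast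
  have "\<exists>K. \<exists>s\<in>below r2. finite K \<and> card K = l \<and> (\<forall>k\<in>K. A (?c k) s)" for l
  proof (induction l)
    case 0
    then show ?case using below_refl[OF conds(3)] by (intro exI[of _ "{}"]) auto
  next
    case (Suc l)
    then obtain K s where s: "s \<in> below r2" "finite K" "card K = l" "\<forall>k\<in>K. A (?c k) s" by blast
    have sc: "s \<in> conds P" using s(1) by (rule below_conds)
    \<comment> \<open>A member beyond the maximum of \<open>K\<close> is new; inserting 0 keeps the
      maximum meaningful for empty \<open>K\<close>.\<close>
    obtain k t where k: "k \<ge> Suc (Max (insert 0 K))" "t \<in> below s" "A (?c k) t"
      using unbounded[OF below_trans[OF s(1) r2p p]] by blast
    have "k' < k" if "k' \<in> K" for k'
    proof -
      have "k' \<le> Max (insert 0 K)" by (rule Max_ge) (use s(2) that in auto)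
      then show ?thesis using k(1) by linarith
    qed
    then have "k \<notin> K" by blast
    moreover have "A (?c k') t" if "k' \<in> K" for k'
      using regular_mono[of "A (?c k')", OF _ k(2) sc A[OF check_nat_names]] s(4) that by blast
    ultimately have "finite (insert k K)" "card (insert k K) = Suc l" "\<forall>k'\<in>insert k K. A (?c k') t"
      using s k by auto
    moreover have "t \<in> below r2" using k(2) s(1) conds(3) by (rule below_trans)
    ultimately show ?case by blast
  qed
  then obtain K s where s: "s \<in> below r2" "finite K" "card K = Suc N" "\<forall>k\<in>K. A (?c k) s" by metis
  have sc: "s \<in> conds P" using s(1) by (rule below_conds)
  \<comment> \<open>One condition decides preimages below \<open>N\<close> for all members of
    \<open>K\<close>. Two members then share a preimage, and single-valuedness of \<open>f\<close>
    forces these different numbers to be equal.\<close>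
  have "\<exists>t\<in>below s. \<exists>h. \<forall>k\<in>K. h k < N \<and> (pair_name P (?c (h k)) (?c k) \<^bold>\<in> f) t"
  proof (rule simultaneously_decide[where \<Phi> = "\<lambda>k i t. i < N \<and> (pair_name P (?c i) (?c k) \<^bold>\<in> f) t",
        OF s(2) sc])
    show "regular (\<lambda>t. i < N \<and> (pair_name P (?c i) (?c k) \<^bold>\<in> f) t)" for i k
      by (rule regular_conj_const[OF regular_mem])
    fix k assume k: "k \<in> K"
    have *: "densely (\<lambda>r. \<exists>x\<in>names P. (x \<^bold>\<in> n) r \<and> (pair_name P x (?c k) \<^bold>\<in> f) r) s"
      using is_bij_onto[OF f(2) conds(3) s(1) _ check_nat_names A] s(4) k by blast
    show "densely (\<lambda>t. \<exists>i. i < N \<and> (pair_name P (?c i) (?c k) \<^bold>\<in> f) t) s"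
    proof (rule denselyI)
      fix t assume t: "t \<in> below s"
      obtain u where u: "u \<in> below t" "\<exists>x\<in>names P. (x \<^bold>\<in> n) u \<and> (pair_name P x (?c k) \<^bold>\<in> f) u"
        using * t by (rule denselyE)
      then obtain x where x: "x \<in> names P" "(x \<^bold>\<in> n) u" "(pair_name P x (?c k) \<^bold>\<in> f) u" by blast
      have tc: "t \<in> conds P" "u \<in> conds P" using t u(1) below_conds by blast+
      have "u \<in> below r1" using u(1) t s(1) r2 conds sc below_trans by blast
      then have "(n \<^bold>= ?c N) u"
        using regular_mono[OF N _ conds(2) regular_eq] n(1) check_nat_names by blast
      then have "(x \<^bold>\<in> ?c N) u" by (rule mem_eq[OF x(2)]) (use x n(1) tc check_nat_names in auto)
      then obtain v where v: "v \<in> below u" "\<exists>i<N. (x \<^bold>= ?c i) v"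
        unfolding mem_check_nat using tc(2) by (rule denselyE_refl)
      then obtain i where i: "i < N" "(x \<^bold>= ?c i) v" by blast
      have vc: "v \<in> conds P" using v(1) by (rule below_conds)
      have "(pair_name P x (?c k) \<^bold>= pair_name P (?c i) (?c k)) v"
        using vc x(1) i(2) check_nat_names by (intro pair_cong eq_refl)
      moreover have "(pair_name P x (?c k) \<^bold>\<in> f) v"
        using regular_mono[OF x(3) v(1) tc(2) regular_mem] .
      ultimately have "(pair_name P (?c i) (?c k) \<^bold>\<in> f) v"
        by (rule eq_mem_left) (use vc f(1) x(1) check_nat_names pair_name_names in auto)
      then show "\<exists>r\<in>below t. \<exists>i. i < N \<and> (pair_name P (?c i) (?c k) \<^bold>\<in> f) r"
        using below_trans[OF v(1) u(1) tc(1)] i(1) by blast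
    qed
  qed
  then obtain t h where t: "t \<in> below s" "\<forall>k\<in>K. h k < N \<and> (pair_name P (?c (h k)) (?c k) \<^bold>\<in> f) t"
    by blast
  have "h ` K \<subseteq> {..<N}" using t(2) by auto
  then have "\<not> inj_on h K" using s(2,3) card_inj_on_le[of h K "{..<N}"] by auto
  then obtain k k' where k: "k \<in> K" "k' \<in> K" "h k = h k'" "k \<noteq> k'" unfolding inj_on_def by blast
  have tr: "t \<in> below r2" using t(1) s(1) conds(3) by (rule below_trans)
  have "is_fun P f (\<lambda>i. i \<^bold>\<in> n) A r2" using f(2) unfolding is_bij_def fand_def by blast
  then have "(?c k \<^bold>= ?c k') t"
    by (rule is_fun_unique[where x = "?c (h k)"]) (use conds tr t(2) k check_nat_names in auto)
  then show False using check_nat_inj below_conds[OF t(1)] k(4) by blast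
qed

lemma fandI: "\<lbrakk>\<phi> p; \<psi> p\<rbrakk> \<Longrightarrow> (\<phi> \<^bold>\<and> \<psi>) p"
  by (simp add: fand_def)

lemma fallI: "(\<And>a. a \<in> names P \<Longrightarrow> \<Phi> a p) \<Longrightarrow> fall P \<Phi> p"
  by (simp add: fall_def)

lemma fex_inI:
  assumes "x \<in> names P" "A x p" "\<Phi> x p" "regular (A x)" "regular (\<Phi> x)" "p \<in> conds P"
  shows "fex_in P A \<Phi> p"
  unfolding fex_in_eq
proof (rule densely_now[OF assms(6)])
  fix q assume "q \<in> below p"
  then have "A x q" "\<Phi> x q" using assms regular_mono by blast+
  then show "\<exists>a\<in>names P. A a q \<and> \<Phi> a q" using assms(1) by blast
qed

lemma fimp_conjI:
  assumes "p \<in> conds P" "regular \<phi>" "regular \<psi>" "regular \<theta>"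
    and "\<And>q. q \<in> below p \<Longrightarrow> \<phi> q \<Longrightarrow> \<psi> q \<Longrightarrow> \<theta> q"
  shows "(\<phi> \<^bold>\<and> \<psi> \<^bold>\<longrightarrow> \<theta>) p"
  by (subst fimp_iff) (use assms in \<open>auto simp: fand_def[of \<phi> \<psi>] regular_fand[unfolded fand_def]
      intro: regular_persistent\<close>)

text \<open>An enumeration of \<open>S\<close> in the ground model yields a canonical name for its
  graph. That this graph is a bijection onto \<open>a\<close> reduces, through \<open>fI\<close> and
  \<open>fD\<close>, to properties of the enumeration.\<close>

lemma not_infinite_if_finite:
  fixes a :: "('i::infinite, 'p) name"
  assumes p: "p \<in> conds P" and a: "a \<in> names P" and "finite S"
    and mem_a: "\<And>x q. x \<in> names P \<Longrightarrow> q \<in> below p \<Longrightarrow>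
      (x \<^bold>\<in> a) q \<longleftrightarrow> densely (\<lambda>r. \<exists>m\<in>S. (x \<^bold>= check_nat P m) r) q"
  shows "\<not> is_infinite P (\<lambda>x. x \<^bold>\<in> a) p"
proof -
  let ?c = "check_nat P :: nat \<Rightarrow> ('i, 'p) name"
  define N where "N = card S"
  obtain e where e: "bij_betw e {..<N} S"
    using \<open>finite S\<close> ex_bij_betw_nat_finite[of S] unfolding N_def atLeast0LessThan by blast
  define F where "F = (\<lambda>i. pair_name P (?c i) (?c (e i))) ` {..<N}"
  define f where "f = set_name F"
  have F: "countable F" "F \<subseteq> names P"
    by (auto simp: F_def check_nat_names pair_name_names)
  then have f: "f \<in> names P" unfolding f_def by (intro set_name_names)
  let ?A = "\<lambda>i. i \<^bold>\<in> ?c N" and ?B = "\<lambda>k. k \<^bold>\<in> a"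
  have B: "?B y q \<longleftrightarrow> densely (\<lambda>r. \<exists>i<N. (y \<^bold>= ?c (e i)) r) q" if "y \<in> names P" "q \<in> below p" for y q
    unfolding mem_a[OF that] using e by (intro densely_cong) (auto simp: bij_betw_def)
  have e_mem: "?B (?c (e i)) r" if i: "i < N" and r: "r \<in> below p" for i r
    unfolding B[OF check_nat_names r]
  proof (rule densely_now[OF below_conds[OF r]])
    fix s assume "s \<in> below r"
    then have "(?c (e i) \<^bold>= ?c (e i)) s" by (intro eq_refl check_nat_names below_conds)
    then show "\<exists>j<N. (?c (e i) \<^bold>= ?c (e j)) s" using i by blast
  qed
  have fI: "(pair_name P x y \<^bold>\<in> f) q"
    if "i < N" "(x \<^bold>= ?c i) q" "(y \<^bold>= ?c (e i)) q" "q \<in> conds P" "x \<in> names P" "y \<in> names P" for x y i q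
    unfolding f_def
  proof (rule mem_set_name_eq)
    show "(pair_name P x y \<^bold>= pair_name P (?c i) (?c (e i))) q"
      using that check_nat_names by (intro pair_cong)
  qed (use that F pair_name_names in \<open>auto simp: F_def\<close>)
  have fD: "densely (\<lambda>r. \<exists>i<N. (x \<^bold>= ?c i) r \<and> (y \<^bold>= ?c (e i)) r) q"
    if "(pair_name P x y \<^bold>\<in> f) q" "x \<in> names P" "y \<in> names P" for x y q
  proof -
    have "densely (\<lambda>r. \<exists>c\<in>F. (pair_name P x y \<^bold>= c) r) q"
      using that(1) unfolding f_def mem_set_name[OF F(1)] .
    also have "?this \<longleftrightarrow> ?thesis"
      by (rule densely_cong) (auto simp: F_def pair_eq_iff that check_nat_names)
    finally show ?thesis .
  qed
  \<comment> \<open>The remaining goals are regular, so each may be verified after an index below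
    \<open>N\<close> has been decided.\<close>
  have dest: "\<theta> q" if "densely (\<lambda>r. \<exists>i<N. \<phi> i r) q" "q \<in> below p" "regular \<theta>"
    "\<And>i r. i < N \<Longrightarrow> r \<in> below q \<Longrightarrow> r \<in> conds P \<Longrightarrow> \<phi> i r \<Longrightarrow> \<theta> r" for \<phi> :: "nat \<Rightarrow> 'p sentence" and \<theta> q
    using that(1) below_conds[OF that(2)] that(3)
    by (rule regular_densely_dest) (use that(4) below_conds in blast)
  have unique: "i = j" if "(x \<^bold>= ?c i) q" "(x \<^bold>= ?c j) q" "x \<in> names P" "q \<in> conds P" for x i j q
    using eq_trans[OF eq_sym[OF that(1)] that(2)] that check_nat_names check_nat_inj by blast
  have "is_bij P f ?A ?B p"
    unfolding is_bij_def is_fun_def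
  proof (intro fandI fallI)
    show "fall_in P (\<lambda>z. z \<^bold>\<in> f) (\<lambda>z. fex_in P ?A (\<lambda>x. fex_in P ?B (\<lambda>y. z \<^bold>= pair_name P x y))) p"
    proof (subst fall_in_iff; (intro ballI impI)?)
      fix z :: "('i, 'p) name" and q assume z: "z \<in> names P" "q \<in> below p" "(z \<^bold>\<in> f) q"
      have "densely (\<lambda>r. \<exists>i<N. (z \<^bold>= pair_name P (?c i) (?c (e i))) r) q"
        using z(3) unfolding f_def mem_set_name[OF F(1)] by (simp add: F_def Bex_def)
      then show "fex_in P ?A (\<lambda>x. fex_in P ?B (\<lambda>y. z \<^bold>= pair_name P x y)) q"
      proof (rule dest[OF _ z(2) regular_fex_in])
        fix i r assume i: "i < N" "r \<in> below q" "r \<in> conds P" "(z \<^bold>= pair_name P (?c i) (?c (e i))) r"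
        have rp: "r \<in> below p" using i(2) z(2) p by (rule below_trans)
        have "?B (?c (e i)) r" using i(1) rp by (rule e_mem)
        then have "fex_in P ?B (\<lambda>y. z \<^bold>= pair_name P (?c i) y) r"
          by (rule fex_inI[rotated])
            (use i z(1) check_nat_names in \<open>auto intro!: regular_intros pair_name_names\<close>)
        then show "fex_in P ?A (\<lambda>x. fex_in P ?B (\<lambda>y. z \<^bold>= pair_name P x y)) r"
          by (rule fex_inI[rotated 2])
            (use i(1,3) in \<open>auto intro!: mem_check_natI check_nat_names regular_mem regular_fex_in\<close>)
      qed
    qed (use p in \<open>auto intro: regular_intros\<close>)
    show "fall_in P ?A (\<lambda>x. fex_in P ?B (\<lambda>y. pair_name P x y \<^bold>\<in> f)) p"
    proof (subst fall_in_iff; (intro ballI impI)?)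
      fix x :: "('i, 'p) name" and q assume x: "x \<in> names P" "q \<in> below p" "(x \<^bold>\<in> ?c N) q"
      from x(3) show "fex_in P ?B (\<lambda>y. pair_name P x y \<^bold>\<in> f) q"
        unfolding mem_check_nat
      proof (rule dest[OF _ x(2) regular_fex_in])
        fix i r assume i: "i < N" "r \<in> below q" "r \<in> conds P" "(x \<^bold>= ?c i) r"
        have rp: "r \<in> below p" using i(2) x(2) p by (rule below_trans)
        have "?B (?c (e i)) r" using i(1) rp by (rule e_mem)
        moreover have "(pair_name P x (?c (e i)) \<^bold>\<in> f) r"
          using fI[OF i(1,4) eq_refl[OF check_nat_names i(3)] i(3) x(1) check_nat_names] .
        ultimately show "fex_in P ?B (\<lambda>y. pair_name P x y \<^bold>\<in> f) r"
          by (intro fex_inI[where x = "?c (e i)"] check_nat_names regular_mem i(3))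
      qed
    qed (use p in \<open>auto intro: regular_intros\<close>)
    show "fall_in P ?B (\<lambda>y. fex_in P ?A (\<lambda>x. pair_name P x y \<^bold>\<in> f)) p"
    proof (subst fall_in_iff; (intro ballI impI)?)
      fix y :: "('i, 'p) name" and q assume y: "y \<in> names P" "q \<in> below p" "(y \<^bold>\<in> a) q"
      from y(3) show "fex_in P ?A (\<lambda>x. pair_name P x y \<^bold>\<in> f) q"
        unfolding B[OF y(1,2)]
      proof (rule dest[OF _ y(2) regular_fex_in])
        fix i r assume i: "i < N" "r \<in> below q" "r \<in> conds P" "(y \<^bold>= ?c (e i)) r"
        show "fex_in P ?A (\<lambda>x. pair_name P x y \<^bold>\<in> f) r"
          using fI[OF i(1) eq_refl[OF check_nat_names i(3)] i(4) i(3) check_nat_names y(1)]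
          by (intro fex_inI[where x = "?c i"] mem_check_natI[OF i(1,3)] check_nat_names regular_mem i(3))
      qed
    qed (use p in \<open>auto intro: regular_intros\<close>)
    fix x y z :: "('i, 'p) name" assume n: "x \<in> names P" "y \<in> names P" "z \<in> names P"
    show "(pair_name P x y \<^bold>\<in> f \<^bold>\<and> pair_name P x z \<^bold>\<in> f \<^bold>\<longrightarrow> y \<^bold>= z) p"
    proof (rule fimp_conjI[OF p regular_mem regular_mem regular_eq[OF n(2,3)]])
      fix q assume q: "q \<in> below p" "(pair_name P x y \<^bold>\<in> f) q" "(pair_name P x z \<^bold>\<in> f) q"
      show "(y \<^bold>= z) q"
      proof (rule dest[OF fD[OF q(2) n(1,2)] q(1) regular_eq[OF n(2,3)]], elim conjE)
        fix i r assume i: "r \<in> below q" "r \<in> conds P" "(x \<^bold>= ?c i) r" "(y \<^bold>= ?c (e i)) r"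
        have rp: "r \<in> below p" using i(1) q(1) p by (rule below_trans)
        have "(pair_name P x z \<^bold>\<in> f) r"
          using regular_mono[OF q(3) i(1) below_conds[OF q(1)] regular_mem] .
        from fD[OF this n(1,3)] show "(y \<^bold>= z) r"
        proof (rule dest[OF _ rp regular_eq[OF n(2,3)]], elim conjE)
          fix j s assume j: "s \<in> below r" "s \<in> conds P" "(x \<^bold>= ?c j) s" "(z \<^bold>= ?c (e j)) s"
          have s: "(x \<^bold>= ?c i) s" "(y \<^bold>= ?c (e i)) s"
            using i(3,4) regular_mono[OF _ j(1) i(2) regular_eq] n check_nat_names by blast+
          have "i = j" using unique[OF s(1) j(3) n(1) j(2)] .
          then show "(y \<^bold>= z) s"
            using eq_trans[OF s(2) eq_sym j(2)] j(4) n check_nat_names by blast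
        qed
      qed
    qed
    show "(pair_name P x z \<^bold>\<in> f \<^bold>\<and> pair_name P y z \<^bold>\<in> f \<^bold>\<longrightarrow> x \<^bold>= y) p"
    proof (rule fimp_conjI[OF p regular_mem regular_mem regular_eq[OF n(1,2)]])
      fix q assume q: "q \<in> below p" "(pair_name P x z \<^bold>\<in> f) q" "(pair_name P y z \<^bold>\<in> f) q"
      show "(x \<^bold>= y) q"
      proof (rule dest[OF fD[OF q(2) n(1,3)] q(1) regular_eq[OF n(1,2)]], elim conjE)
        fix i r assume i: "i < N" "r \<in> below q" "r \<in> conds P" "(x \<^bold>= ?c i) r" "(z \<^bold>= ?c (e i)) r"
        have rp: "r \<in> below p" using i(2) q(1) p by (rule below_trans)
        have "(pair_name P y z \<^bold>\<in> f) r"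
          using regular_mono[OF q(3) i(2) below_conds[OF q(1)] regular_mem] .
        from fD[OF this n(2,3)] show "(x \<^bold>= y) r"
        proof (rule dest[OF _ rp regular_eq[OF n(1,2)]], elim conjE)
          fix j s assume j: "j < N" "s \<in> below r" "s \<in> conds P" "(y \<^bold>= ?c j) s" "(z \<^bold>= ?c (e j)) s"
          have s: "(x \<^bold>= ?c i) s" "(z \<^bold>= ?c (e i)) s"
            using i(4,5) regular_mono[OF _ j(2) i(3) regular_eq] n check_nat_names by blast+
          have "e i = e j" using unique[OF s(2) j(5) n(3) j(3)] .
          then have "i = j" using e i(1) j(1) by (auto simp: bij_betw_def inj_on_def)
          then show "(x \<^bold>= y) s"
            using eq_trans[OF s(1) eq_sym j(3)] j(4) n check_nat_names by blast
        qed
      qed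
    qed
  qed
  moreover have "regular (is_bij P f ?A ?B)"
    unfolding is_bij_def by (intro regular_fand regular_is_fun regular_intros)
  ultimately have "fex P (\<lambda>f. is_bij P f ?A ?B) p"
    unfolding fex_eq using f regular_mono[OF _ _ p] by (intro densely_now[OF p]) blast
  moreover have "(?c N \<^bold>\<in> omega_name P) p"
    unfolding omega_name_def by (rule mem_check_setI) (use p in auto)
  ultimately have "fex_in P (in_omega P) (\<lambda>n. fex P (\<lambda>f. is_bij P f (\<lambda>i. i \<^bold>\<in> n) ?B)) p"
    by (intro fex_inI[where x = "?c N"] check_nat_names regular_in_omega regular_fex p)
      (simp_all add: in_omega_def)
  then show ?thesis unfolding is_infinite_def fnot_iff using below_refl[OF p] by blast
qed

lemma regular_is_infinite: "regular (is_infinite P A)"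
  unfolding is_infinite_def by (intro regular_intros)

text \<open>Otherwise no condition below \<open>q\<close> forces a number from \<open>m\<close> on
  into \<open>a\<close>. Deciding membership in \<open>a\<close> of the numbers below
  \<open>m\<close> then identifies \<open>a\<close> with a finite set of the ground model.\<close>

lemma unbounded_if_infinite:
  fixes a :: "('i::infinite, 'p) name"
  assumes p: "p \<in> conds P" and a: "a \<in> names P" and sub: "(a \<^bold>\<subseteq> omega_name P) p"
    and inf: "is_infinite P (\<lambda>x. x \<^bold>\<in> a) p" and q: "q \<in> below p"
  shows "\<exists>n\<ge>m. \<exists>r\<in>below q. (check_nat P n \<^bold>\<in> a) r"
proof (rule ccontr)
  let ?c = "check_nat P :: nat \<Rightarrow> ('i, 'p) name"
  assume none: "\<not> ?thesis"
  have qc: "q \<in> conds P" using q by (rule below_conds)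
  have "\<exists>r\<in>below q. \<exists>h. \<forall>i\<in>{..<m}. (if h i then ?c i \<^bold>\<in> a else \<^bold>\<not> (?c i \<^bold>\<in> a)) r"
  proof (rule simultaneously_decide[where \<Phi> = "\<lambda>i j. if j then ?c i \<^bold>\<in> a else \<^bold>\<not> (?c i \<^bold>\<in> a)", OF _ qc])
    show "regular (if j then ?c i \<^bold>\<in> a else \<^bold>\<not> (?c i \<^bold>\<in> a))" for i j
      by (simp add: regular_mem regular_fnot regular_persistent)
    show "densely (\<lambda>r. \<exists>j. (if j then ?c i \<^bold>\<in> a else \<^bold>\<not> (?c i \<^bold>\<in> a)) r) q" for i
    proof (rule denselyI)
      fix r assume "r \<in> below q"
      then have r: "r \<in> below r" using below_conds below_refl by blast
      show "\<exists>s\<in>below r. \<exists>j. (if j then ?c i \<^bold>\<in> a else \<^bold>\<not> (?c i \<^bold>\<in> a)) s"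
      proof (cases "\<exists>s\<in>below r. (?c i \<^bold>\<in> a) s")
        case True
        then show ?thesis by (metis (full_types))
      next
        case False
        then have "(\<^bold>\<not> (?c i \<^bold>\<in> a)) r" unfolding fnot_iff by blast
        then show ?thesis using r by (metis (full_types))
      qed
    qed
  qed simp
  then obtain r h where r: "r \<in> below q"
    "\<And>i. i < m \<Longrightarrow> (if h i then ?c i \<^bold>\<in> a else \<^bold>\<not> (?c i \<^bold>\<in> a)) r" by blast
  define S where "S = {i. i < m \<and> h i}"
  have rc: "r \<in> conds P" using r(1) by (rule below_conds)
  have rp: "r \<in> below p" using r(1) q p by (rule below_trans)
  have "\<not> is_infinite P (\<lambda>x. x \<^bold>\<in> a) r"
  proof (rule not_infinite_if_finite[OF rc a])
    show "finite S" by (simp add: S_def)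
    fix x :: "('i, 'p) name" and s assume x: "x \<in> names P" and s: "s \<in> below r"
    have sc: "s \<in> conds P" using s by (rule below_conds)
    have sp: "s \<in> below p" using s rp p by (rule below_trans)
    show "(x \<^bold>\<in> a) s \<longleftrightarrow> densely (\<lambda>r. \<exists>m\<in>S. (x \<^bold>= ?c m) r) s"
    proof
      assume xa: "(x \<^bold>\<in> a) s"
      have "(x \<^bold>\<in> omega_name P) s"
        using sub x sp xa unfolding fsubset_def
        by (subst (asm) fall_in_iff[OF _ _ p]) (auto intro: regular_persistent regular_mem)
      then have "densely (\<lambda>r. \<exists>m. (x \<^bold>= ?c m) r) s" unfolding mem_omega .
      then show "densely (\<lambda>r. \<exists>m\<in>S. (x \<^bold>= ?c m) r) s"
      proof (rule densely_mono[OF _ sc])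
        fix t assume t: "t \<in> below s" "\<exists>k. (x \<^bold>= ?c k) t"
        then obtain k where k: "(x \<^bold>= ?c k) t" by blast
        have tc: "t \<in> conds P" using t(1) by (rule below_conds)
        have tr: "t \<in> below r" using t(1) s rc by (rule below_trans)
        have "(x \<^bold>\<in> a) t" using regular_mono[OF xa t(1) sc regular_mem] .
        then have ka: "(?c k \<^bold>\<in> a) t"
          by (rule eq_mem_left[OF k _ tc a check_nat_names x])
        have "t \<in> below q" using tr r(1) qc by (rule below_trans)
        then have "k < m" using none ka by (meson not_le)
        moreover have "h k"
        proof (rule ccontr)
          assume "\<not> h k"
          then have "(\<^bold>\<not> (?c k \<^bold>\<in> a)) r" using r(2)[OF \<open>k < m\<close>] by simp
          then show False using ka tr unfolding fnot_iff by blast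
        qed
        ultimately show "\<exists>m\<in>S. (x \<^bold>= ?c m) t" using k by (auto simp: S_def)
      qed
    next
      assume "densely (\<lambda>r. \<exists>m\<in>S. (x \<^bold>= ?c m) r) s"
      then show "(x \<^bold>\<in> a) s"
      proof (rule regular_densely_dest[OF _ sc regular_mem])
        fix t assume t: "t \<in> below s" "\<exists>k\<in>S. (x \<^bold>= ?c k) t"
        then obtain k where k: "k \<in> S" "(x \<^bold>= ?c k) t" by blast
        have tc: "t \<in> conds P" using t(1) by (rule below_conds)
        have tr: "t \<in> below r" using t(1) s rc by (rule below_trans)
        have "(?c k \<^bold>\<in> a) r" using r(2)[of k] k(1) by (simp add: S_def)
        then have "(?c k \<^bold>\<in> a) t" using regular_mono[OF _ tr rc regular_mem] by blast
        then show "(x \<^bold>\<in> a) t" by (rule eq_mem_left[OF eq_sym[OF k(2)] _ tc a x check_nat_names])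
      qed
    qed
  qed
  moreover have "is_infinite P (\<lambda>x. x \<^bold>\<in> a) r" using regular_mono[OF inf rp p regular_is_infinite] .
  ultimately show False by contradiction
qed

text \<open>A pair in the canonical sequence whose first coordinate is \<open>i\<close> comes from
  an index that is forced equal to \<open>j\<close>, hence is \<open>j\<close>. Allowing any name
  \<open>i\<close> makes the result applicable to indices quantified in the extension.\<close>

lemma in_value_check:
  fixes i :: "('i::infinite, 'p) name"
  assumes p: "p \<in> conds P" and i: "i \<in> names P" "(i \<^bold>= check_nat P j) p"
  shows "in_value P (check_nat P k) (check_seq P X) i p \<longleftrightarrow> k \<in> X j"
proof -
  let ?c = "check_nat P :: nat \<Rightarrow> ('i, 'p) name"
  let ?X = "\<lambda>n. check_set P (X n) :: ('i, 'p) name"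
  let ?G = "range (\<lambda>n. pair_name P (?c n) (?X n))"
  have G: "countable ?G" "?G \<subseteq> names P"
    by (auto simp: check_nat_names check_set_names pair_name_names)
  show ?thesis
  proof
    assume "in_value P (?c k) (check_seq P X) i p"
    then have "densely (\<lambda>r. \<exists>y\<in>names P. (pair_name P i y \<^bold>\<in> check_seq P X) r \<and> (?c k \<^bold>\<in> y) r) p"
      unfolding in_value_def fex_eq fand_def .
    then obtain q where q: "q \<in> below p"
      "\<exists>y\<in>names P. (pair_name P i y \<^bold>\<in> check_seq P X) q \<and> (?c k \<^bold>\<in> y) q"
      using p by (rule denselyE_refl)
    then obtain y where y: "y \<in> names P" "(pair_name P i y \<^bold>\<in> check_seq P X) q" "(?c k \<^bold>\<in> y) q"
      by blast
    have qc: "q \<in> conds P" using q(1) by (rule below_conds)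
    obtain r where r: "r \<in> below q" "\<exists>g\<in>?G. (pair_name P i y \<^bold>= g) r"
      using y(2) qc unfolding check_seq_eq mem_set_name[OF G(1)] by (rule denselyE_refl)
    then obtain n where "(pair_name P i y \<^bold>= pair_name P (?c n) (?X n)) r" by blast
    moreover have rc: "r \<in> conds P" using r(1) by (rule below_conds)
    ultimately have n: "(i \<^bold>= ?c n) r" "(y \<^bold>= ?X n) r"
      by (simp_all add: pair_eq_iff i(1) y(1) check_nat_names check_set_names)
    have "r \<in> below p" using r(1) q(1) p by (rule below_trans)
    then have "(i \<^bold>= ?c j) r" by (rule regular_mono[OF i(2) _ p regular_eq[OF i(1) check_nat_names]])
    then have "(?c n \<^bold>= ?c j) r"
      by (rule eq_trans[OF eq_sym[OF n(1)] _ rc check_nat_names i(1) check_nat_names])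
    then have "n = j" using rc by (rule check_nat_inj)
    have "(?c k \<^bold>\<in> y) r" using regular_mono[OF y(3) r(1) qc regular_mem] .
    then have "(?c k \<^bold>\<in> ?X n) r"
      by (rule mem_eq[OF _ n(2) rc y(1) check_set_names check_nat_names])
    then show "k \<in> X j" using check_nat_mem_check_set[OF rc] \<open>n = j\<close> by blast
  next
    assume k: "k \<in> X j"
    show "in_value P (?c k) (check_seq P X) i p"
      unfolding in_value_def fex_eq fand_def
    proof (rule densely_now[OF p])
      fix q assume q: "q \<in> below p"
      have qc: "q \<in> conds P" using q by (rule below_conds)
      have "(i \<^bold>= ?c j) q" by (rule regular_mono[OF i(2) q p regular_eq[OF i(1) check_nat_names]])
      then have "(pair_name P i (?X j) \<^bold>= pair_name P (?c j) (?X j)) q"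
        by (simp add: pair_eq_iff qc i(1) check_nat_names check_set_names eq_refl)
      then have "(pair_name P i (?X j) \<^bold>\<in> check_seq P X) q"
        unfolding check_seq_eq
        by (rule mem_set_name_eq) (use G qc i(1) in \<open>auto intro: pair_name_names check_set_names\<close>)
      moreover have "(?c k \<^bold>\<in> ?X j) q" using k qc by (rule mem_check_setI)
      ultimately show "\<exists>y\<in>names P. (pair_name P i y \<^bold>\<in> check_seq P X) q \<and> (?c k \<^bold>\<in> y) q"
        using check_set_names by blast
    qed
  qed
qed

text \<open>A function from \<open>n + 1\<close> to 2 in the extension is finite, so its values are
  decided by a condition and form a pattern \<open>s\<close> of the ground model. The assumption for
  this pattern provides unboundedly many potential members of the cell.\<close>

lemma promptly_splits_if:
  fixes a :: "('i::infinite, 'p) name"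
  assumes p: "p \<in> conds P" and a: "a \<in> names P"
    and X: "\<And>N s q m. q \<in> below p \<Longrightarrow>
      \<exists>k\<ge>m. (\<forall>i\<le>N. k \<in> X i \<longleftrightarrow> s i) \<and> (\<exists>r\<in>below q. (check_nat P k \<^bold>\<in> a) r)"
  shows "promptly_splits P (check_seq P X) a p"
proof -
  let ?c = "check_nat P :: nat \<Rightarrow> ('i, 'p) name" and ?X = "check_seq P X :: ('i, 'p) name"
  define succ :: "('i, 'p) name \<Rightarrow> ('i, 'p) name \<Rightarrow> 'p sentence"
    where "succ n i = (i \<^bold>\<in> n \<^bold>\<or> i \<^bold>= n)" for n i
  define two :: "('i, 'p) name \<Rightarrow> 'p sentence" where "two j = (j \<^bold>= ?c 0 \<^bold>\<or> j \<^bold>= ?c 1)" for j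
  \<comment> \<open>Truth is coded by 0, in keeping with the convention that exponent 0 leaves a set
    unchanged and exponent 1 complements it.\<close>
  define val where "val b = ?c (if b then 0 else 1)" for b :: bool
  define body where "body \<sigma> k i = ((pair_name P i (?c 0) \<^bold>\<in> \<sigma> \<^bold>\<longrightarrow> in_value P k ?X i) \<^bold>\<and>
    (pair_name P i (?c 1) \<^bold>\<in> \<sigma> \<^bold>\<longrightarrow> in_omega P k \<^bold>\<and> (\<^bold>\<not> in_value P k ?X i)))" for \<sigma> k i
  define cell where "cell n \<sigma> k = (fall_in P (succ n) (body \<sigma> k) \<^bold>\<and> k \<^bold>\<in> a)" for n \<sigma> k
  have reg: "regular (succ n i)" "regular (body \<sigma> k i)" for n i \<sigma> k
    unfolding succ_def body_def by (intro regular_intros)+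
  have reg_cell: "regular (cell n \<sigma> k)" for n \<sigma> k
    unfolding cell_def by (intro regular_fand regular_fall_in reg regular_mem)
  have val: "val b \<in> names P" for b by (simp add: val_def check_nat_names)
  have infinite: "is_infinite P (cell n \<sigma>) t"
    if n: "n \<in> names P" "(n \<^bold>= ?c N) t" and \<sigma>: "\<sigma> \<in> names P" "is_fun P \<sigma> (succ n) two t"
      and t: "t \<in> below p" for n \<sigma> N t
  proof (rule regular_dense[OF regular_is_infinite below_conds[OF t]])
    fix u assume u: "u \<in> below t"
    have tc: "t \<in> conds P" and uc: "u \<in> conds P" using t u below_conds by blast+
    have "\<exists>v\<in>below u. \<exists>s. \<forall>i\<in>{..N}. (pair_name P (?c i) (val (s i)) \<^bold>\<in> \<sigma>) v"
    proof (rule simultaneously_decide[where \<Phi> = "\<lambda>i j. pair_name P (?c i) (val j) \<^bold>\<in> \<sigma>",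
          OF _ uc regular_mem])
      fix i assume "i \<in> {..N}"
      have nu: "(?c N \<^bold>= n) u"
        using eq_sym[OF regular_mono[OF n(2) u tc regular_eq[OF n(1) check_nat_names]]] .
      have "(?c i \<^bold>\<in> n) u \<or> (?c i \<^bold>= n) u"
      proof (cases "i = N")
        case False
        then have "(?c i \<^bold>\<in> ?c N) u" using \<open>i \<in> {..N}\<close> uc by (intro mem_check_natI) auto
        then show ?thesis using mem_eq[OF _ nu uc check_nat_names n(1) check_nat_names] by blast
      qed (use nu in simp)
      then have "succ n (?c i) u"
        unfolding succ_def f_or_eq using regular_mono[OF _ _ uc] regular_mem
          regular_eq[OF check_nat_names n(1)]
        by (intro densely_now[OF uc]) blast
      then have "densely (\<lambda>r. \<exists>y\<in>names P. two y r \<and> (pair_name P (?c i) y \<^bold>\<in> \<sigma>) r) u"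
        using \<sigma>(2) tc u check_nat_names reg(1) by (intro is_fun_total[where A = "succ n"])
      then show "densely (\<lambda>r. \<exists>j. (pair_name P (?c i) (val j) \<^bold>\<in> \<sigma>) r) u"
      proof (rule regular_densely_dest[OF _ uc regular_densely])
        fix v assume v: "v \<in> below u" "\<exists>y\<in>names P. two y v \<and> (pair_name P (?c i) y \<^bold>\<in> \<sigma>) v"
        then obtain y where y: "y \<in> names P" "two y v" "(pair_name P (?c i) y \<^bold>\<in> \<sigma>) v" by blast
        have vc: "v \<in> conds P" using v(1) by (rule below_conds)
        from y(2) show "densely (\<lambda>r. \<exists>j. (pair_name P (?c i) (val j) \<^bold>\<in> \<sigma>) r) v"
          unfolding two_def f_or_eq
        proof (rule densely_mono[OF _ vc])
          fix w assume w: "w \<in> below v" "(y \<^bold>= ?c 0) w \<or> (y \<^bold>= ?c 1) w"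
          have wc: "w \<in> conds P" using w(1) by (rule below_conds)
          obtain j where "(y \<^bold>= val j) w"
            using w(2) unfolding val_def by (metis (full_types))
          then have "(pair_name P (?c i) y \<^bold>= pair_name P (?c i) (val j)) w"
            by (simp add: pair_eq_iff wc y(1) val check_nat_names eq_refl)
          moreover have "(pair_name P (?c i) y \<^bold>\<in> \<sigma>) w"
            using regular_mono[OF y(3) w(1) vc regular_mem] .
          ultimately have "(pair_name P (?c i) (val j) \<^bold>\<in> \<sigma>) w"
            by (rule eq_mem_left) (use wc \<sigma>(1) y(1) val in \<open>auto intro: pair_name_names check_nat_names\<close>)
          then show "\<exists>j. (pair_name P (?c i) (val j) \<^bold>\<in> \<sigma>) w" by blast
        qed
      qed
    qed simp
    then obtain v s where v: "v \<in> below u" and s: "\<And>i. i \<le> N \<Longrightarrow> (pair_name P (?c i) (val (s i)) \<^bold>\<in> \<sigma>) v"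
      by blast
    have vc: "v \<in> conds P" using v by (rule below_conds)
    have vt: "v \<in> below t" using v u tc by (rule below_trans)
    \<comment> \<open>The names of 0 and 1 are never forced equal, so any value forced at a name of
      \<open>j\<close> must be the one already decided.\<close>
    have decided: "b = s j" if "(pair_name P i (val b) \<^bold>\<in> \<sigma>) r" "(i \<^bold>= ?c j) r" "j \<le> N"
      "i \<in> names P" "r \<in> below v" for b i j r
    proof -
      have rc: "r \<in> conds P" using that(5) by (rule below_conds)
      have rt: "r \<in> below t" using that(5) vt tc by (rule below_trans)
      have "(pair_name P i (val b) \<^bold>= pair_name P (?c j) (val b)) r"
        using that(2) by (simp add: pair_eq_iff rc that(4) val check_nat_names eq_refl)
      then have "(pair_name P (?c j) (val b) \<^bold>\<in> \<sigma>) r"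
        using that(1)
        by (rule eq_mem_left) (use rc \<sigma>(1) that(4) val in \<open>auto intro: pair_name_names check_nat_names\<close>)
      moreover have "(pair_name P (?c j) (val (s j)) \<^bold>\<in> \<sigma>) r"
        using regular_mono[OF s[OF that(3)] that(5) vc regular_mem] .
      ultimately have "(val b \<^bold>= val (s j)) r"
        by (rule is_fun_unique[OF \<sigma>(2) tc rt _ _ check_nat_names val val])
      then show ?thesis using check_nat_inj[OF _ rc] unfolding val_def by (metis zero_neq_one)
    qed
    have "is_infinite P (cell n \<sigma>) v"
    proof (rule is_infinite_if_unbounded[OF vc reg_cell])
      fix q m assume q: "q \<in> below v"
      then have qp: "q \<in> below p" using vt t p tc below_trans by blast
      obtain k r where k: "k \<ge> m" "\<forall>i\<le>N. k \<in> X i \<longleftrightarrow> s i" and r: "r \<in> below q" "(?c k \<^bold>\<in> a) r"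
        using X[OF qp, of m N s] by blast
      have rv: "r \<in> below v" using r(1) q vc by (rule below_trans)
      have rc: "r \<in> conds P" using r(1) by (rule below_conds)
      have "fall_in P (succ n) (body \<sigma> (?c k)) r"
      proof (subst fall_in_iff[OF _ _ rc]; (intro ballI impI regular_persistent reg)?)
        fix i :: "('i, 'p) name" and x assume i: "i \<in> names P" "x \<in> below r" "succ n i x"
        have xc: "x \<in> conds P" using i(2) by (rule below_conds)
        have xv: "x \<in> below v" using i(2) rv vc by (rule below_trans)
        \<comment> \<open>Although \<open>i\<close> ranges over names in the extension, it is
          densely one of the finitely many numbers up to \<open>N\<close>.\<close>
        have "densely (\<lambda>y. \<exists>j\<le>N. (i \<^bold>= ?c j) y) x"
        proof (rule regular_densely_dest[OF i(3)[unfolded succ_def f_or_eq] xc regular_densely])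
          fix y assume y: "y \<in> below x" "(i \<^bold>\<in> n) y \<or> (i \<^bold>= n) y"
          have yc: "y \<in> conds P" using y(1) by (rule below_conds)
          have "y \<in> below t" using y(1) xv vt xc vc tc below_trans by blast
          then have ny: "(n \<^bold>= ?c N) y"
            by (rule regular_mono[OF n(2) _ tc regular_eq[OF n(1) check_nat_names]])
          from y(2) show "densely (\<lambda>y. \<exists>j\<le>N. (i \<^bold>= ?c j) y) y"
          proof
            assume "(i \<^bold>\<in> n) y"
            then have "(i \<^bold>\<in> ?c N) y" by (rule mem_eq[OF _ ny yc n(1) check_nat_names i(1)])
            then show ?thesis unfolding mem_check_nat
              by (rule densely_mono[OF _ yc]) (use less_imp_le in blast)
          next
            assume "(i \<^bold>= n) y"
            then have eq: "(i \<^bold>= ?c N) y" by (rule eq_trans[OF _ ny yc i(1) n(1) check_nat_names])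
            show ?thesis
              by (rule densely_now[OF yc])
                (use regular_mono[OF eq _ yc regular_eq[OF i(1) check_nat_names]] in blast)
          qed
        qed
        then show "body \<sigma> (?c k) i x"
        proof (rule regular_densely_dest[OF _ xc reg(2)])
          fix y assume y: "y \<in> below x" "\<exists>j\<le>N. (i \<^bold>= ?c j) y"
          then obtain j where j: "j \<le> N" "(i \<^bold>= ?c j) y" by blast
          have yc: "y \<in> conds P" using y(1) by (rule below_conds)
          have jz: "(i \<^bold>= ?c j) z" if "z \<in> below y" for z
            by (rule regular_mono[OF j(2) that yc regular_eq[OF i(1) check_nat_names]])
          have zv: "z \<in> below v" if "z \<in> below y" for z
            using that y(1) xv xc vc below_trans by blast
          have value_iff: "in_value P (?c k) ?X i z \<longleftrightarrow> s j" if "z \<in> below y" for z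
            using in_value_check[OF below_conds[OF that] i(1) jz[OF that]] k(2) j(1) by blast
          show "body \<sigma> (?c k) i y"
            unfolding body_def
          proof (rule fandI)
            show "(pair_name P i (?c 0) \<^bold>\<in> \<sigma> \<^bold>\<longrightarrow> in_value P (?c k) ?X i) y"
            proof (subst fimp_iff[OF _ _ yc]; (intro ballI impI regular_intros)?)
              fix z assume z: "z \<in> below y" "(pair_name P i (?c 0) \<^bold>\<in> \<sigma>) z"
              have "s j"
                using decided[of i True z j] z jz[OF z(1)] j(1) i(1) zv[OF z(1)] by (simp add: val_def)
              then show "in_value P (?c k) ?X i z" using value_iff[OF z(1)] by simp
            qed
            show "(pair_name P i (?c 1) \<^bold>\<in> \<sigma> \<^bold>\<longrightarrow> in_omega P (?c k) \<^bold>\<and> (\<^bold>\<not> in_value P (?c k) ?X i)) y"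
            proof (subst fimp_iff[OF _ _ yc]; (intro ballI impI regular_intros)?)
              fix z assume z: "z \<in> below y" "(pair_name P i (?c 1) \<^bold>\<in> \<sigma>) z"
              have "\<not> s j"
                using decided[of i False z j] z jz[OF z(1)] j(1) i(1) zv[OF z(1)] by (simp add: val_def)
              then have "(\<^bold>\<not> in_value P (?c k) ?X i) z"
                unfolding fnot_iff using value_iff below_trans[OF _ z(1) yc] by blast
              moreover have "in_omega P (?c k) z"
                unfolding in_omega_def omega_name_def
                by (rule mem_check_setI) (use below_conds[OF z(1)] in auto)
              ultimately show "(in_omega P (?c k) \<^bold>\<and> (\<^bold>\<not> in_value P (?c k) ?X i)) z"
                by (intro fandI)
            qed
          qed
        qed
      qed
      then have "cell n \<sigma> (?c k) r" unfolding cell_def using r(2) by (rule fandI)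
      then show "\<exists>n'\<ge>m. \<exists>r\<in>below q. cell n \<sigma> (?c n') r" using k(1) r(1) by blast
    qed
    then show "\<exists>v\<in>below u. is_infinite P (cell n \<sigma>) v" using v by blast
  qed
  have reg_split: "regular (fall_in P (\<lambda>\<sigma>. is_fun P \<sigma> (succ n) two) (\<lambda>\<sigma>. is_infinite P (cell n \<sigma>)))"
    for n
    by (intro regular_fall_in regular_is_fun reg regular_is_infinite)
  have "fall_in P (in_omega P) (\<lambda>n.
      fall_in P (\<lambda>\<sigma>. is_fun P \<sigma> (succ n) two) (\<lambda>\<sigma>. is_infinite P (cell n \<sigma>))) p"
  proof (subst fall_in_iff[OF _ _ p]; (intro ballI impI regular_persistent regular_in_omega reg_split)?)
    fix n :: "('i, 'p) name" and q assume n: "n \<in> names P" "q \<in> below p" "in_omega P n q"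
    from n(3) show "fall_in P (\<lambda>\<sigma>. is_fun P \<sigma> (succ n) two) (\<lambda>\<sigma>. is_infinite P (cell n \<sigma>)) q"
      unfolding in_omega_def mem_omega
    proof (rule regular_densely_dest[OF _ below_conds[OF n(2)] reg_split])
      fix r assume r: "r \<in> below q" "\<exists>m. (n \<^bold>= ?c m) r"
      then obtain N where N: "(n \<^bold>= ?c N) r" by blast
      have rc: "r \<in> conds P" using r(1) by (rule below_conds)
      have rp: "r \<in> below p" using r(1) n(2) p by (rule below_trans)
      show "fall_in P (\<lambda>\<sigma>. is_fun P \<sigma> (succ n) two) (\<lambda>\<sigma>. is_infinite P (cell n \<sigma>)) r"
      proof (subst fall_in_iff[OF _ _ rc]; (intro ballI impI regular_persistent
            regular_is_fun reg regular_is_infinite)?)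
        fix \<sigma> :: "('i, 'p) name" and t assume \<sigma>: "\<sigma> \<in> names P" "t \<in> below r" "is_fun P \<sigma> (succ n) two t"
        have "(n \<^bold>= ?c N) t" using regular_mono[OF N \<sigma>(2) rc regular_eq[OF n(1) check_nat_names]] .
        then show "is_infinite P (cell n \<sigma>) t"
          using infinite[OF n(1) _ \<sigma>(1,3) below_trans[OF \<sigma>(2) rp p]] by blast
      qed
    qed
  qed
  then show ?thesis
    by (simp add: promptly_splits_def Let_def cell_def[abs_def] body_def[abs_def] succ_def[abs_def]
        two_def[abs_def])
qed

end

section \<open>Suslin forcing\<close>

locale suslin_forcing = forcing P for P :: "(nat \<Rightarrow> nat, 'm) forcing_scheme" (structure) +
  assumes suslin: "suslin_ccc P"
begin

lemma ccc: "ccc P"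
  using suslin by (simp add: suslin_ccc_def)

text \<open>A point \<open>y\<close> of Baire space codes, by rows, a bound \<open>m\<close>, a condition \<open>p\<close>, a witness that \<open>p\<close> is
  below \<open>p0\<close>, and witnesses for all the required incompatibilities.\<close>

lemma avoiding_sets_projection:
  assumes A: "\<And>n. A n \<subseteq> conds P" "\<And>n::nat. countable (A n)" and p0: "p0 \<in> conds P"
  obtains C :: "((nat \<Rightarrow> bool) \<times> (nat \<Rightarrow> nat)) set" where "limit_closed C"
    "fst ` C = {x. \<exists>p\<in>below p0. \<exists>m. \<forall>n\<ge>m. x n \<longrightarrow> (\<forall>r\<in>A n. incompatible P p r)}"
proof -
  define R1 where "R1 = {(q, p). q \<in> conds P \<and> p \<in> conds P \<and> q \<preceq> p}"
  define R2 where "R2 = {(p, q). p \<in> conds P \<and> q \<in> conds P \<and> incompatible P p q}"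
  have R: "analytic_set R1" "analytic_set R2"
    using suslin unfolding suslin_ccc_def R1_def R2_def by auto
  obtain D1 :: "(((nat \<Rightarrow> nat) \<times> (nat \<Rightarrow> nat)) \<times> (nat \<Rightarrow> nat)) set"
    where D1': "closed D1" "R1 = fst ` D1" using R(1) by (rule analytic_set_projection)
  obtain D2 :: "(((nat \<Rightarrow> nat) \<times> (nat \<Rightarrow> nat)) \<times> (nat \<Rightarrow> nat)) set"
    where D2': "closed D2" "R2 = fst ` D2" using R(2) by (rule analytic_set_projection)
  have D1: "z \<in> R1 \<longleftrightarrow> (\<exists>y. (z, y) \<in> D1)" and D2: "z \<in> R2 \<longleftrightarrow> (\<exists>y. (z, y) \<in> D2)" for z
    unfolding D1'(2) D2'(2) fst_eq_Domain Domain_iff by (rule refl)+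
  define S where "S = (SIGMA n:UNIV. A n)"
  have S: "countable S" unfolding S_def using A(2) by (intro countable_SIGMA) auto
  define row :: "nat \<Rightarrow> (nat \<Rightarrow> nat) \<Rightarrow> nat \<Rightarrow> nat" where "row j y k = y (prod_encode (j, k))" for j y k
  \<comment> \<open>Rows 0, 1 and 2 are reserved for the bound, the condition and its witness. The
    requirements in the countable set \<open>S\<close> receive the rows from 3 on.\<close>
  define idx where "idx n r = 3 + to_nat_on S (n, r)" for n r
  define T1 where "T1 = {y. ((row 1 y, p0), row 2 y) \<in> D1}"
  define T2 where "T2 n r = {y. ((row 1 y, r), row (idx n r) y) \<in> D2}" for n r
  define C where "C = {(x, y). y \<in> T1 \<and> (\<forall>n\<ge>row 0 y 0. x n \<longrightarrow> (\<forall>r\<in>A n. y \<in> T2 n r))}"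
  have row: "continuous_on UNIV (row j)" for j
    unfolding row_def
    by (intro continuous_on_coordinatewise_then_product continuous_on_product_coordinates)
  have T1: "closed T1"
    unfolding T1_def using closed_vimage[OF D1'(1), of "\<lambda>y. ((row 1 y, p0), row 2 y)"]
    by (simp add: vimage_def row continuous_on_Pair)
  have T2: "closed (T2 n r)" for n r
    unfolding T2_def using closed_vimage[OF D2'(1), of "\<lambda>y. ((row 1 y, r), row (idx n r) y)"]
    by (simp add: vimage_def row continuous_on_Pair)
  have "limit_closed C"
    unfolding limit_closed_def
  proof (intro allI impI)
    fix x y assume agree: "\<forall>k. \<exists>(x', y')\<in>C. \<forall>i<k. x' i = x i \<and> y' i = y i"
    have "y \<in> T1"
    proof (rule closed_if_agree[OF T1])
      fix k
      obtain x' y' where "(x', y') \<in> C" "\<forall>i<k. x' i = x i \<and> y' i = y i" using agree by blast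
      then show "\<exists>y'\<in>T1. \<forall>i<k. y' i = y i" unfolding C_def by (intro bexI[of _ y']) simp_all
    qed
    moreover have "y \<in> T2 n r" if n: "n \<ge> row 0 y 0" "x n" "r \<in> A n" for n r
    proof (rule closed_if_agree[OF T2])
      fix k
      \<comment> \<open>Agreement up to \<open>K\<close> fixes the truth value of \<open>x n\<close>
        and the entry of \<open>y\<close> storing the bound. The approximating point is therefore
        subject to the same requirement.\<close>
      define K where "K = Max {k, Suc n, Suc (prod_encode (0, 0))}"
      have K: "k \<le> K" "n < K" "prod_encode (0, 0) < K" unfolding K_def by simp_all
      obtain x' y' where C: "(x', y') \<in> C" and eq: "\<forall>i<K. x' i = x i \<and> y' i = y i"
        using agree by blast
      have "row 0 y' 0 = row 0 y 0" "x' n" using eq K n(2) by (auto simp: row_def)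
      then have "y' \<in> T2 n r" using C n(1,3) by (simp add: C_def)
      then show "\<exists>y'\<in>T2 n r. \<forall>i<k. y' i = y i" using eq K(1) by (intro bexI[of _ y']) auto
    qed
    ultimately show "(x, y) \<in> C" by (simp add: C_def)
  qed
  moreover have "x \<in> fst ` C \<longleftrightarrow>
      (\<exists>p\<in>below p0. \<exists>m. \<forall>n\<ge>m. x n \<longrightarrow> (\<forall>r\<in>A n. incompatible P p r))" (is "_ \<longleftrightarrow> ?avoids") for x
  proof
    assume "x \<in> fst ` C"
    then obtain y where y: "y \<in> T1" "\<And>n r. \<lbrakk>n \<ge> row 0 y 0; x n; r \<in> A n\<rbrakk> \<Longrightarrow> y \<in> T2 n r"
      by (auto simp: C_def)
    have "row 1 y \<in> below p0" using y(1) D1[of "(row 1 y, p0)"] by (auto simp: R1_def T1_def below_def)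
    moreover have "incompatible P (row 1 y) r" if "n \<ge> row 0 y 0" "x n" "r \<in> A n" for n r
      using y(2)[OF that] D2[of "(row 1 y, r)"] by (auto simp: R2_def T2_def)
    ultimately show ?avoids by blast
  next
    assume ?avoids
    then obtain p m where p: "p \<in> below p0"
      and m: "\<And>n r. \<lbrakk>n \<ge> m; x n; r \<in> A n\<rbrakk> \<Longrightarrow> incompatible P p r" by blast
    obtain y0 where y0: "((p, p0), y0) \<in> D1"
      using D1[of "(p, p0)"] p p0 by (auto simp: R1_def below_def)
    have "\<exists>z. n \<ge> m \<longrightarrow> x n \<longrightarrow> r \<in> A n \<longrightarrow> ((p, r), z) \<in> D2" for n r
      using D2[of "(p, r)"] m[of n r] A(1)[of n] p by (auto simp: R2_def below_def)
    then obtain z where z: "\<And>n r. \<lbrakk>n \<ge> m; x n; r \<in> A n\<rbrakk> \<Longrightarrow> ((p, r), z n r) \<in> D2" by metis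
    define v where "v j = (if j = 0 then \<lambda>_. m else if j = 1 then p else if j = 2 then y0
      else case from_nat_into S (j - 3) of (n, r) \<Rightarrow> z n r)" for j
    define y where "y i = (case prod_decode i of (j, k) \<Rightarrow> v j k)" for i
    have row_y: "row j y = v j" for j by (auto simp: row_def y_def)
    have rows: "row 0 y = (\<lambda>_. m)" "row 1 y = p" "row 2 y = y0" by (simp_all add: row_y v_def)
    have "row (idx n r) y = z n r" if "r \<in> A n" for n r
      using that S by (simp add: row_y v_def idx_def S_def)
    then have "(x, y) \<in> C"
      unfolding C_def T1_def T2_def using y0 z by (simp add: rows del: One_nat_def)
    then show "x \<in> fst ` C" by force
  qed
  then have "fst ` C = {x. \<exists>p\<in>below p0. \<exists>m. \<forall>n\<ge>m. x n \<longrightarrow> (\<forall>r\<in>A n. incompatible P p r)}"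
    by (intro set_eqI) simp
  ultimately show ?thesis by (rule that)
qed

text \<open>Names have been eliminated: compatibility of \<open>q\<close> with a member of
  \<open>A k\<close> stands for the possibility of forcing \<open>k\<close> into \<open>a\<close>
  below \<open>q\<close>.\<close>

lemma splitting_sequence:
  assumes A: "\<And>n. A n \<subseteq> conds P" "\<And>n::nat. countable (A n)" and p0: "p0 \<in> conds P"
    and unbounded: "\<And>q m. q \<in> below p0 \<Longrightarrow> \<exists>k\<ge>m. \<exists>r\<in>A k. \<not> incompatible P q r"
  shows "\<exists>X :: nat \<Rightarrow> nat set. \<forall>q\<in>below p0. \<forall>N s m.
    \<exists>k\<ge>m. (\<forall>i\<le>N. k \<in> X i \<longleftrightarrow> s i) \<and> (\<exists>r\<in>A k. \<not> incompatible P q r)"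
proof -
  obtain C :: "((nat \<Rightarrow> bool) \<times> (nat \<Rightarrow> nat)) set" where closed: "limit_closed C"
    and C: "fst ` C = {x. \<exists>p\<in>below p0. \<exists>m. \<forall>n\<ge>m. x n \<longrightarrow> (\<forall>r\<in>A n. incompatible P p r)}"
    by (rule avoiding_sets_projection[of A, OF A p0])
  show ?thesis
  proof (cases rule: analytic_dichotomy[of C, OF closed, case_names small large])
    case (small n g)
    define X where "X i = (\<Union>l\<in>{l. i \<in> block_label l}. {n l..<n (Suc l)})" for i
    show ?thesis
    proof (intro exI[of _ X] ballI allI, rule ccontr)
      fix q N s m
      assume q: "q \<in> below p0"
        and *: "\<not> (\<exists>k\<ge>m. (\<forall>i\<le>N. k \<in> X i \<longleftrightarrow> s i) \<and> (\<exists>r\<in>A k. \<not> incompatible P q r))"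
      \<comment> \<open>A cell that \<open>q\<close> avoids from \<open>m\<close> on stays avoided
        when it is cut down by \<open>g\<close>. The smaller set matches \<open>g\<close> and thus
        contradicts the choice of \<open>g\<close>.\<close>
      let ?x = "\<lambda>k. (\<forall>i\<le>N. k \<in> X i \<longleftrightarrow> s i) \<and> g k"
      have "\<forall>k\<ge>m. ?x k \<longrightarrow> (\<forall>r\<in>A k. incompatible P q r)" using * by blast
      then have "?x \<in> fst ` C" unfolding C using q by blast
      moreover have "matches n g ?x"
        using patterns_match[OF small(1)] unfolding X_def .
      ultimately show False using small(3) by blast
    qed
  next
    case (large s n g)
    obtain x :: "(nat \<Rightarrow> bool) \<Rightarrow> nat \<Rightarrow> bool" where x: "\<And>\<beta>. x \<beta> \<in> cyl s" "\<And>\<beta>. matches n g (x \<beta>)"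
      "\<And>\<beta> \<gamma>. \<beta> \<noteq> \<gamma> \<Longrightarrow> \<exists>M. \<forall>k\<ge>M. x \<beta> k \<or> x \<gamma> k"
      using almost_codisjoint_family[OF large(1), of s g] by blast
    have "\<exists>p\<in>below p0. \<exists>m. \<forall>k\<ge>m. x \<beta> k \<longrightarrow> (\<forall>r\<in>A k. incompatible P p r)" for \<beta>
      using large(3)[OF x(1,2)] unfolding C by simp
    then obtain p m where p: "\<And>\<beta>. p \<beta> \<in> below p0"
      and m: "\<And>\<beta> k r. \<lbrakk>k \<ge> m \<beta>; x \<beta> k; r \<in> A k\<rbrakk> \<Longrightarrow> incompatible P (p \<beta>) r" by metis
    \<comment> \<open>A common extension would be incompatible with every member of
      \<open>A k\<close> for all large \<open>k\<close>, since each such \<open>k\<close> belongs to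
      one of the two sets; this contradicts \<open>unbounded\<close>.\<close>
    have inc: "incompatible P (p \<beta>) (p \<gamma>)" if "\<beta> \<noteq> \<gamma>" for \<beta> \<gamma>
    proof (rule ccontr)
      assume "\<not> ?thesis"
      then obtain q where q: "q \<in> below (p \<beta>)" "q \<in> below (p \<gamma>)" unfolding incompatible_iff by blast
      obtain M where M: "\<forall>k\<ge>M. x \<beta> k \<or> x \<gamma> k" using x(3)[OF \<open>\<beta> \<noteq> \<gamma>\<close>] by blast
      have "q \<in> below p0" using q(1) p p0 by (rule below_trans)
      then obtain k r where k: "k \<ge> Max {M, m \<beta>, m \<gamma>}" "r \<in> A k" "\<not> incompatible P q r"
        using unbounded by blast
      have "\<not> incompatible P (p \<delta>) r" if "q \<in> below (p \<delta>)" for \<delta>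
        using k(3) below_trans[OF _ that] below_conds[OF p] unfolding incompatible_iff by blast
      moreover have "incompatible P (p \<beta>) r \<or> incompatible P (p \<gamma>) r"
        using M m k(1,2) by auto
      ultimately show False using q by blast
    qed
    have inj: "inj p"
    proof (rule injI, rule ccontr)
      fix \<beta> \<gamma> assume "p \<beta> = p \<gamma>" "\<beta> \<noteq> \<gamma>"
      then show False
        using inc[of \<beta> \<gamma>] below_refl[OF below_conds[OF p]] unfolding incompatible_iff by auto
    qed
    have "\<forall>u\<in>range p. \<forall>v\<in>range p. u \<noteq> v \<longrightarrow> incompatible P u v"
    proof clarify
      fix \<beta> \<gamma> assume "p \<beta> \<noteq> p \<gamma>"
      then have "\<beta> \<noteq> \<gamma>" by blast
      then show "incompatible P (p \<beta>) (p \<gamma>)" by (rule inc)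
    qed
    moreover have "range p \<subseteq> conds P" using p below_conds by blast
    ultimately have "countable (range p)"
      using ccc[unfolded ccc_def, THEN spec[of _ "range p"]] by blast
    then have "countable (UNIV :: (nat \<Rightarrow> bool) set)" using inj by (rule countable_image_inj_on)
    then show ?thesis using uncountable_sequences by contradiction
  qed
qed

text \<open>Zorn's lemma gives an antichain maximal within \<open>Q\<close>, countable by the chain
  condition. A member of \<open>Q\<close> incompatible with all of it could be added to it.\<close>

lemma countable_maximal_antichain:
  assumes "Q \<subseteq> conds P"
  shows "\<exists>A. A \<subseteq> Q \<and> countable A \<and> (\<forall>q\<in>Q. \<exists>r\<in>A. \<not> incompatible P q r)"
proof -
  define antichains where "antichains = {A. A \<subseteq> Q \<and> (\<forall>p\<in>A. \<forall>q\<in>A. p \<noteq> q \<longrightarrow> incompatible P p q)}"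
  have "\<exists>A\<in>antichains. \<forall>B\<in>antichains. A \<subseteq> B \<longrightarrow> B = A"
  proof (rule subset_Zorn_nonempty)
    show "antichains \<noteq> {}" by (auto simp: antichains_def)
    fix \<C> assume "\<C> \<noteq> {}" and chain: "subset.chain antichains \<C>"
    have sub: "B \<subseteq> Q" "\<And>p q. \<lbrakk>p \<in> B; q \<in> B; p \<noteq> q\<rbrakk> \<Longrightarrow> incompatible P p q" if "B \<in> \<C>" for B
      using that chain unfolding subset_chain_def antichains_def by blast+
    have "incompatible P p q" if "B \<in> \<C>" "p \<in> B" "D \<in> \<C>" "q \<in> D" "p \<noteq> q" for p q B D
    proof -
      have "B \<subseteq> D \<or> D \<subseteq> B" using chain that(1,3) unfolding subset_chain_def by blast
      then show ?thesis using sub(2)[of B p q] sub(2)[of D p q] that by blast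
    qed
    then show "\<Union>\<C> \<in> antichains" unfolding antichains_def using sub(1) by blast
  qed
  then obtain A where A: "A \<in> antichains" and maximal: "\<And>B. B \<in> antichains \<Longrightarrow> A \<subseteq> B \<Longrightarrow> B = A"
    by blast
  have "\<exists>r\<in>A. \<not> incompatible P q r" if q: "q \<in> Q" for q
  proof (rule ccontr)
    assume *: "\<not> ?thesis"
    then have "insert q A \<in> antichains"
      using A q unfolding antichains_def incompatible_iff by auto
    then have "q \<in> A" using maximal by blast
    then show False using * q assms below_refl unfolding incompatible_iff by blast
  qed
  moreover have "A \<subseteq> Q" and antichain: "\<forall>p\<in>A. \<forall>q\<in>A. p \<noteq> q \<longrightarrow> incompatible P p q"
    using A by (simp_all add: antichains_def)
  moreover from \<open>A \<subseteq> Q\<close> have "A \<subseteq> conds P" using assms by (rule subset_trans)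
  then have "countable A" using antichain ccc[unfolded ccc_def, THEN spec[of _ A]] by blast
  ultimately show ?thesis by blast
qed

lemma exists_promptly_splitting:
  fixes a :: "('i::infinite, nat \<Rightarrow> nat) name"
  assumes p: "p \<in> conds P" and a: "a \<in> names P" and sub: "(a \<^bold>\<subseteq> omega_name P) p"
    and inf: "is_infinite P (\<lambda>k. k \<^bold>\<in> a) p"
  obtains X :: "nat \<Rightarrow> nat set" where "promptly_splits P (check_seq P X) a p"
proof -
  define Q where "Q n = {q \<in> conds P. (check_nat P n \<^bold>\<in> a) q}" for n
  have "\<exists>A. A \<subseteq> Q n \<and> countable A \<and> (\<forall>q\<in>Q n. \<exists>r\<in>A. \<not> incompatible P q r)" for n
    by (rule countable_maximal_antichain) (simp add: Q_def)
  then obtain A where "\<forall>n. A n \<subseteq> Q n \<and> countable (A n) \<and> (\<forall>q\<in>Q n. \<exists>r\<in>A n. \<not> incompatible P q r)"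
    by metis
  then have A: "A n \<subseteq> Q n" "countable (A n)" "q \<in> Q n \<Longrightarrow> \<exists>r\<in>A n. \<not> incompatible P q r" for n q
    by blast+
  have "\<exists>k\<ge>m. \<exists>r\<in>A k. \<not> incompatible P q r" if q: "q \<in> below p" for q m
  proof -
    obtain k s where k: "k \<ge> m" "s \<in> below q" "(check_nat P k \<^bold>\<in> a) s"
      using unbounded_if_infinite[OF p a sub inf q] by blast
    then have "s \<in> Q k" by (simp add: Q_def below_conds)
    then obtain r where r: "r \<in> A k" "\<not> incompatible P s r" using A(3) by blast
    then have "\<not> incompatible P q r"
      using below_trans[OF _ k(2) below_conds[OF q]] unfolding incompatible_iff by blast
    with r k show ?thesis by blast
  qed
  moreover have "A n \<subseteq> conds P" for n using A(1) by (auto simp: Q_def)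
  ultimately obtain X :: "nat \<Rightarrow> nat set" where X: "\<forall>q\<in>below p. \<forall>N s m.
    \<exists>k\<ge>m. (\<forall>i\<le>N. k \<in> X i \<longleftrightarrow> s i) \<and> (\<exists>r\<in>A k. \<not> incompatible P q r)"
    using splitting_sequence[of A p] A(2) p by blast
  have "promptly_splits P (check_seq P X) a p"
  proof (rule promptly_splits_if[OF p a])
    fix N s q m assume "q \<in> below p"
    with X obtain k r where k: "k \<ge> m" "\<forall>i\<le>N. k \<in> X i \<longleftrightarrow> s i"
      and r: "r \<in> A k" "\<not> incompatible P q r" by blast
    \<comment> \<open>A common extension of \<open>q\<close> and \<open>r\<close> forces
      \<open>k\<close> into \<open>a\<close>, because \<open>r\<close> already does.\<close>
    obtain t where t: "t \<in> below q" "t \<in> below r" using r(2) unfolding incompatible_iff by blast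
    have "(check_nat P k \<^bold>\<in> a) r" "r \<in> conds P" using A(1) r(1) by (auto simp: Q_def)
    then have "(check_nat P k \<^bold>\<in> a) t" using regular_mono[OF _ t(2) _ regular_mem] by blast
    then show "\<exists>k\<ge>m. (\<forall>i\<le>N. k \<in> X i \<longleftrightarrow> s i) \<and> (\<exists>r\<in>below q. (check_nat P k \<^bold>\<in> a) r)"
      using k t(1) by blast
  qed
  then show ?thesis by (rule that)
qed

end

theorem theorem2p15:
  fixes P :: "(nat \<Rightarrow> nat, 'm) forcing_scheme" (structure)
  assumes "suslin_ccc P"
  shows "\<tturnstile> fall P (\<lambda>a :: ('i::infinite, nat \<Rightarrow> nat) name.
    a \<^bold>\<subseteq> omega_name P \<^bold>\<and> is_infinite P (\<lambda>k. k \<^bold>\<in> a) \<^bold>\<longrightarrow>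
    fex_ground P (\<lambda>X :: nat \<Rightarrow> nat set. promptly_splits P (check_seq P X) a))"
proof -
  interpret suslin_forcing P
    by unfold_locales (use assms in \<open>simp_all add: suslin_ccc_def\<close>)
  show ?thesis
    unfolding forced_def
  proof (intro fallI fimp_conjI maxel_conds)
    fix a :: "('i, nat \<Rightarrow> nat) name" and p
    assume a: "a \<in> names P" and p: "p \<in> below (maxel P)" "(a \<^bold>\<subseteq> omega_name P) p"
      "is_infinite P (\<lambda>k. k \<^bold>\<in> a) p"
    have pc: "p \<in> conds P" using p(1) by (rule below_conds)
    have reg: "regular (a \<^bold>\<subseteq> omega_name P)"
      unfolding fsubset_def by (intro regular_intros)
    show "fex_ground P (\<lambda>X. promptly_splits P (check_seq P X) a) p"
      unfolding fex_ground_eq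
    proof (rule densely_now[OF pc])
      \<comment> \<open>The sequence may depend on \<open>q\<close>: existence of a ground model
        object is a density statement, so a separate choice for each \<open>q\<close>
        suffices.\<close>
      fix q assume q: "q \<in> below p"
      show "\<exists>X. promptly_splits P (check_seq P X) a q"
        using exists_promptly_splitting[OF below_conds[OF q] a
            regular_mono[OF p(2) q pc reg] regular_mono[OF p(3) q pc regular_is_infinite]] by blast
    qed
  qed (auto simp: fsubset_def fex_ground_eq intro: regular_densely regular_is_infinite
      regular_fall_in regular_mem)
qed

end
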